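(* Let $X$ be a non-compact proper Busemann space. Let $\xi,\eta\in\partial_gX$ and $[\Phi]\in\partial_hX$ be ideal points such that $\operatorname{Td}([\Phi],\xi)\le\pi/2$ and $\operatorname{Td}([\Phi],\eta)\le\pi/2$. Then $\operatorname{Td}(\xi,\eta)\le\pi$.
   Context: Busemann space: a geodesic metric space $X$ (distance written $|xy|$) such that for any two geodesic segments with affine parameterizations $\gamma:[a,b]\to X$, $\gamma':[a',b']\to X$ the function $(t,t')\mapsto|\gamma(t)\gamma'(t')|$ is convex. Proper means closed balls are compact. A ray is a distance-preserving map $c:\mathbb{R}_+=[0,\infty)\to X$. Two rays are asymptotic if the Hausdorff distance between their images is finite; $\partial_gX$ (geodesic boundary) is the set of asymptoticity classes of rays, and $c(+\infty)$ denotes the class of $c$. For each $x\in X$, $\xi\in\partial_gX$ there is a unique ray $[x\xi]$ starting at $x$ in the class $\xi$. Cone topology on $\partial_gX$: fixing $o\in X$, a base of neighbourhoods of $\xi$ is given by the sets $\{\eta\in\partial_gX : |c_\xi(K)c_\eta(K)|<1\}$, $K>0$, where $c_\xi=[o\xi]$, $c_\eta=[o\eta]$ (independent of $o$). Horofunction boundary: let $C(X,\mathbb{R})$ be the continuous functions with the topology of uniform convergence on bounded sets and $C^*(X,\mathbb{R})=C(X,\mathbb{R})/\{\text{constants}\}$; embed $X$ into $C^*(X,\mathbb{R})$ by $x\mapsto$ class of $y\mapsto|xy|$; $\overline{X}_h$ is the closure of the image and $\partial_hX=\overline{X}_h\setminus X$. A horofunction is a function $\Phi:X\to\mathbb{R}$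 whose class $[\Phi]$ modulo constants lies in $\partial_hX$. The symbol $\operatorname{Td}$ is not a metric; it denotes binary relations. On $\partial_hX\times\partial_gX$: $\operatorname{Td}([\Phi],\xi)\le\pi/2$ means that $\Phi$ is non-increasing on some (equivalently, every) ray $c$ with $c(+\infty)=\xi$, i.e. $\Phi\circ c$ is non-increasing on $\mathbb{R}_+$. On $\partial_gX\times\partial_gX$: for $c=[o\xi]$, $d=[o\eta]$ put $\delta_o(\xi,\eta)=\lim_{t\to+\infty}\frac{|c(t)d(t)|}{2t}\le1$ (independent of $o$); $\operatorname{Td}(\xi,\eta)<\pi$ means $\delta_o(\xi,\eta)<1$; $\operatorname{Td}(\xi,\eta)\le\pi$ means that for any neighbourhoods $U$ of $\xi$ and $V$ of $\eta$ in the cone topology there are $\xi'\in U$, $\eta'\in V$ with $\operatorname{Td}(\xi',\eta')<\pi$. *)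

theory Defs
  imports "HOL-Analysis.Analysis"
begin

section \<open>Proper Busemann spaces\<close>

text \<open>The space \<open>X\<close> is the whole of a type \<open>'a :: metric_space\<close>.\<close>

definition geodesic_space :: "'a::metric_space itself \<Rightarrow> bool" where
  "geodesic_space T \<longleftrightarrow>
    (\<forall>x y :: 'a. \<exists>\<gamma>. \<gamma> 0 = x \<and> \<gamma> (dist x y) = y \<and>
      (\<forall>s\<in>{0..dist x y}. \<forall>t\<in>{0..dist x y}. dist (\<gamma> s) (\<gamma> t) = \<bar>s - t\<bar>))"

definition affine_geodesic :: "real \<Rightarrow> real \<Rightarrow> (real \<Rightarrow> 'a::metric_space) \<Rightarrow> bool" where
  "affine_geodesic a b \<gamma> \<longleftrightarrow>
    a \<le> b \<and> (\<exists>k\<ge>0. \<forall>s\<in>{a..b}. \<forall>t\<in>{a..b}. dist (\<gamma> s) (\<gamma> t) = k * \<bar>s - t\<bar>)"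

definition busemann_space :: "'a::metric_space itself \<Rightarrow> bool" where
  "busemann_space T \<longleftrightarrow> geodesic_space T \<and>
    (\<forall>a b a' b'. \<forall>\<gamma> \<gamma>' :: real \<Rightarrow> 'a.
      affine_geodesic a b \<gamma> \<longrightarrow> affine_geodesic a' b' \<gamma>' \<longrightarrow>
      convex_on ({a..b} \<times> {a'..b'}) (\<lambda>(t, t'). dist (\<gamma> t) (\<gamma>' t')))"

definition proper_space :: "'a::metric_space itself \<Rightarrow> bool" where
  "proper_space T \<longleftrightarrow> (\<forall>(x::'a) r. compact (cball x r))"


section \<open>The geodesic boundary\<close>

text \<open>
  Extensionality on \<open>[0, \<infinity>)\<close> makes elements of \<open>rays\<close> correspond exactly to maps with domain
  \<open>[0, \<infinity>)\<close>; otherwise a ray with given origin and class could never be unique.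
\<close>

definition rays :: "(real \<Rightarrow> 'a::metric_space) set" where
  "rays = {c \<in> extensional {0..}. \<forall>s\<ge>0. \<forall>t\<ge>0. dist (c s) (c t) = \<bar>s - t\<bar>}"

definition hausdorff_distance :: "'a::metric_space set \<Rightarrow> 'a set \<Rightarrow> ennreal" where
  "hausdorff_distance A B =
    max (SUP x\<in>A. INF y\<in>B. ennreal (dist x y)) (SUP y\<in>B. INF x\<in>A. ennreal (dist x y))"

definition asymptotic :: "((real \<Rightarrow> 'a::metric_space) \<times> (real \<Rightarrow> 'a)) set" where
  "asymptotic =
    {(c, d). c \<in> rays \<and> d \<in> rays \<and> hausdorff_distance (c ` {0..}) (d ` {0..}) < \<infinity>}"

definition geodesic_boundary :: "(real \<Rightarrow> 'a::metric_space) set set" where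
  "geodesic_boundary = rays // asymptotic"

text \<open>The ray \<open>[p\<xi>]\<close>.\<close>

definition ray_from :: "'a::metric_space \<Rightarrow> (real \<Rightarrow> 'a) set \<Rightarrow> real \<Rightarrow> 'a" where
  "ray_from p \<xi> = (THE c. c \<in> \<xi> \<and> c 0 = p)"

definition cone_basic :: "'a::metric_space \<Rightarrow> (real \<Rightarrow> 'a) set \<Rightarrow> real \<Rightarrow> (real \<Rightarrow> 'a) set set" where
  "cone_basic p \<xi> K = {\<eta> \<in> geodesic_boundary. dist (ray_from p \<xi> K) (ray_from p \<eta> K) < 1}"

text \<open>
  The cone topology is given by neighbourhood bases; \<open>cone_nhd p \<xi> U\<close> says that \<open>U\<close> is a
  (not necessarily open) neighbourhood of \<open>\<xi>\<close>.
\<close>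

definition cone_nhd :: "'a::metric_space \<Rightarrow> (real \<Rightarrow> 'a) set \<Rightarrow> (real \<Rightarrow> 'a) set set \<Rightarrow> bool" where
  "cone_nhd p \<xi> U \<longleftrightarrow> U \<subseteq> geodesic_boundary \<and> (\<exists>K>0. cone_basic p \<xi> K \<subseteq> U)"


section \<open>The horofunction boundary\<close>

definition cont_functions :: "('a::metric_space \<Rightarrow> real) set" where
  "cont_functions = {f. continuous_on UNIV f}"

definition bounded_uniform_topology :: "('a::metric_space \<Rightarrow> real) topology" where
  "bounded_uniform_topology = topology (\<lambda>U. U \<subseteq> cont_functions \<and>
    (\<forall>f\<in>U. \<exists>B. bounded B \<and> (\<forall>\<^sub>F g in uniformly_on B f. g \<in> cont_functions \<longrightarrow> g \<in> U)))"

lemma uniformly_on_antimono: "A \<subseteq> B \<Longrightarrow> uniformly_on B f \<le> uniformly_on A f"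
  unfolding uniformly_on_def by (intro INF_mono) auto

lemma openin_bounded_uniform_topology:
  "openin bounded_uniform_topology U \<longleftrightarrow> U \<subseteq> cont_functions \<and>
    (\<forall>f\<in>U. \<exists>B. bounded B \<and> (\<forall>\<^sub>F g in uniformly_on B f. g \<in> cont_functions \<longrightarrow> g \<in> U))"
proof -
  let ?P = "\<lambda>f U. \<exists>B. bounded B \<and> (\<forall>\<^sub>F g in uniformly_on B f. g \<in> cont_functions \<longrightarrow> g \<in> U)"
  have inter: "?P f (S \<inter> T)" if "?P f S" "?P f T" for f :: "'a \<Rightarrow> real" and S T
  proof -
    obtain A B where A: "bounded A" "\<forall>\<^sub>F g in uniformly_on A f. g \<in> cont_functions \<longrightarrow> g \<in> S"
      and B: "bounded B" "\<forall>\<^sub>F g in uniformly_on B f. g \<in> cont_functions \<longrightarrow> g \<in> T"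
      using \<open>?P f S\<close> \<open>?P f T\<close> by blast
    have "\<forall>\<^sub>F g in uniformly_on (A \<union> B) f. g \<in> cont_functions \<longrightarrow> g \<in> S"
      by (rule filter_leD[OF uniformly_on_antimono A(2)]) simp
    moreover have "\<forall>\<^sub>F g in uniformly_on (A \<union> B) f. g \<in> cont_functions \<longrightarrow> g \<in> T"
      by (rule filter_leD[OF uniformly_on_antimono B(2)]) simp
    ultimately have "\<forall>\<^sub>F g in uniformly_on (A \<union> B) f. g \<in> cont_functions \<longrightarrow> g \<in> S \<inter> T"
      by eventually_elim blast
    then show ?thesis
      using A(1) B(1) by (intro exI[of _ "A \<union> B"]) simp
  qed
  have upclosed: "?P f T" if "?P f S" "S \<subseteq> T" for f :: "'a \<Rightarrow> real" and S T
  proof -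
    obtain B where B: "bounded B" "\<forall>\<^sub>F g in uniformly_on B f. g \<in> cont_functions \<longrightarrow> g \<in> S"
      using \<open>?P f S\<close> by blast
    have "\<forall>\<^sub>F g in uniformly_on B f. g \<in> cont_functions \<longrightarrow> g \<in> T"
      using B(2) by (rule eventually_mono) (use \<open>S \<subseteq> T\<close> in blast)
    with B(1) show ?thesis by blast
  qed
  have "istopology (\<lambda>U::('a \<Rightarrow> real) set. U \<subseteq> cont_functions \<and> (\<forall>f\<in>U. ?P f U))"
    unfolding istopology_def
  proof (intro conjI allI impI)
    fix S T :: "('a \<Rightarrow> real) set"
    assume "S \<subseteq> cont_functions \<and> (\<forall>f\<in>S. ?P f S)" "T \<subseteq> cont_functions \<and> (\<forall>f\<in>T. ?P f T)"
    then show "S \<inter> T \<subseteq> cont_functions" "\<forall>f\<in>S \<inter> T. ?P f (S \<inter> T)"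
      using inter by blast+
  next
    fix \<K> :: "('a \<Rightarrow> real) set set"
    assume K: "\<forall>S\<in>\<K>. S \<subseteq> cont_functions \<and> (\<forall>f\<in>S. ?P f S)"
    then show "\<Union>\<K> \<subseteq> cont_functions" by blast
    show "\<forall>f\<in>\<Union>\<K>. ?P f (\<Union>\<K>)"
    proof
      fix f assume "f \<in> \<Union>\<K>"
      then obtain S where "S \<in> \<K>" "f \<in> S" by blast
      then show "?P f (\<Union>\<K>)" using K upclosed[of S f "\<Union>\<K>"] by blast
    qed
  qed
  then show ?thesis
    unfolding bounded_uniform_topology_def by simp
qed

lemma topspace_bounded_uniform_topology: "topspace bounded_uniform_topology = cont_functions"
proof -
  have "openin bounded_uniform_topology (cont_functions :: ('a \<Rightarrow> real) set)"
    unfolding openin_bounded_uniform_topology by (auto intro: exI[of _ "{}"])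
  then show ?thesis
    by (meson openin_bounded_uniform_topology openin_subset openin_topspace subset_antisym)
qed

definition differ_by_const :: "(('a::metric_space \<Rightarrow> real) \<times> ('a \<Rightarrow> real)) set" where
  "differ_by_const =
    {(f, g). f \<in> cont_functions \<and> g \<in> cont_functions \<and> (\<exists>k. \<forall>x. g x = f x + k)}"

definition const_class :: "('a::metric_space \<Rightarrow> real) \<Rightarrow> ('a \<Rightarrow> real) set" where
  "const_class f = differ_by_const `` {f}"

text \<open>\<open>C\<^sup>*(X, \<real>) = C(X, \<real>) / {constants}\<close> with the quotient topology.\<close>

definition cont_mod_const_topology :: "('a::metric_space \<Rightarrow> real) set topology" where
  "cont_mod_const_topology = topology (\<lambda>V. V \<subseteq> cont_functions // differ_by_const \<and>
    openin bounded_uniform_topology {f \<in> cont_functions. const_class f \<in> V})"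

lemma openin_cont_mod_const_topology:
  "openin cont_mod_const_topology V \<longleftrightarrow> V \<subseteq> cont_functions // differ_by_const \<and>
    openin bounded_uniform_topology {f \<in> cont_functions. const_class f \<in> V}"
proof -
  let ?pre = "\<lambda>V. {f :: 'a \<Rightarrow> real. f \<in> cont_functions \<and> const_class f \<in> V}"
  have "istopology (\<lambda>V. V \<subseteq> cont_functions // differ_by_const \<and>
          openin bounded_uniform_topology (?pre V))"
    unfolding istopology_def
  proof (intro conjI allI impI)
    fix S T :: "('a \<Rightarrow> real) set set"
    assume S: "S \<subseteq> cont_functions // differ_by_const \<and> openin bounded_uniform_topology (?pre S)"
      and T: "T \<subseteq> cont_functions // differ_by_const \<and> openin bounded_uniform_topology (?pre T)"
    show "S \<inter> T \<subseteq> cont_functions // differ_by_const" using S by blast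
    have "?pre (S \<inter> T) = ?pre S \<inter> ?pre T" by blast
    then show "openin bounded_uniform_topology (?pre (S \<inter> T))"
      using S T by (simp add: openin_Int)
  next
    fix \<K> :: "('a \<Rightarrow> real) set set set"
    assume K: "\<forall>S\<in>\<K>. S \<subseteq> cont_functions // differ_by_const \<and>
                  openin bounded_uniform_topology (?pre S)"
    then show "\<Union>\<K> \<subseteq> cont_functions // differ_by_const" by blast
    have "?pre (\<Union>\<K>) = (\<Union>S\<in>\<K>. ?pre S)" by blast
    then show "openin bounded_uniform_topology (?pre (\<Union>\<K>))"
      using K by (auto intro!: openin_Union)
  qed
  then show ?thesis
    unfolding cont_mod_const_topology_def by simp
qed

definition horo_embedding :: "'a::metric_space \<Rightarrow> ('a \<Rightarrow> real) set" where
  "horo_embedding x = const_class (\<lambda>y. dist x y)"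

definition horo_closure :: "('a::metric_space \<Rightarrow> real) set set" where
  "horo_closure = cont_mod_const_topology closure_of range horo_embedding"

definition horo_boundary :: "('a::metric_space \<Rightarrow> real) set set" where
  "horo_boundary = horo_closure - range horo_embedding"


section \<open>The relations \<open>Td\<close>\<close>

text \<open>
  In \<open>Td_horo_le_half_pi\<close> the choice of the representative \<open>\<Phi>\<close> is immaterial, since
  representatives differ by constants, and the weaker form (some ray instead of every ray of the
  class \<open>\<xi>\<close>) is used. The remaining notions carry the base point \<open>p\<close> as a parameter.
\<close>

definition Td_horo_le_half_pi ::
    "('a::metric_space \<Rightarrow> real) set \<Rightarrow> (real \<Rightarrow> 'a) set \<Rightarrow> bool" where
  "Td_horo_le_half_pi H \<xi> \<longleftrightarrow> (\<exists>\<Phi>\<in>H. \<exists>c\<in>\<xi>. antimono_on {0..} (\<Phi> \<circ> c))"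

definition Td_delta :: "'a::metric_space \<Rightarrow> (real \<Rightarrow> 'a) set \<Rightarrow> (real \<Rightarrow> 'a) set \<Rightarrow> real" where
  "Td_delta p \<xi> \<eta> = Lim at_top (\<lambda>t. dist (ray_from p \<xi> t) (ray_from p \<eta> t) / (2 * t))"

definition Td_less_pi :: "'a::metric_space \<Rightarrow> (real \<Rightarrow> 'a) set \<Rightarrow> (real \<Rightarrow> 'a) set \<Rightarrow> bool" where
  "Td_less_pi p \<xi> \<eta> \<longleftrightarrow> Td_delta p \<xi> \<eta> < 1"

definition Td_le_pi :: "'a::metric_space \<Rightarrow> (real \<Rightarrow> 'a) set \<Rightarrow> (real \<Rightarrow> 'a) set \<Rightarrow> bool" where
  "Td_le_pi p \<xi> \<eta> \<longleftrightarrow>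
    (\<forall>U V. cone_nhd p \<xi> U \<longrightarrow> cone_nhd p \<eta> V \<longrightarrow> (\<exists>\<xi>'\<in>U. \<exists>\<eta>'\<in>V. Td_less_pi p \<xi>' \<eta>'))"

end

theory Submission
  imports Defs "HOL-Library.Diagonal_Subsequence"
begin

text \<open>
  Let \<open>c = [p\<xi>]\<close> and \<open>d = [p\<eta>]\<close>, with \<open>\<Phi> p = 0\<close>. Since \<open>\<Phi>\<close> can be decreased at unit speed from every
  point, \<open>c\<close> can be replaced by a nearby ray, again called \<open>c\<close>, such that \<open>\<Phi>\<close> decreases linearly along it, with asymptotic slope
  \<open>- e1 < 0\<close>. Let \<open>y\<^sub>n\<close> divide the segment from \<open>c n\<close> to \<open>d n\<close> in the ratio \<open>s : 1 - s\<close>, with \<open>s\<close> small. By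
  convexity \<open>\<Phi> y\<^sub>n \<le> - (1 - s) e1 n\<close>, so \<open>|p y\<^sub>n| / n\<close> accumulates at some \<open>a > 0\<close>, and the segments
  \<open>[p y\<^sub>n]\<close> accumulate at a ray \<open>b\<close> close to \<open>c\<close>.

  If \<open>b \<noteq> c\<close>, uniqueness of geodesics gives \<open>|b(a k) c(k)| > (1 - a) k\<close> for some \<open>k\<close>. This strict excess
  propagates outwards because \<open>|b(a t) c(t)| / t\<close> is nondecreasing; hence \<open>|y\<^sub>n c(n)|\<close> exceeds
  \<open>(1 - a) n\<close> linearly, which leaves \<open>|y\<^sub>n d(n)| \<le> (1 + a - \<kappa>) n\<close>. If \<open>b = c\<close>, comparing the slope of
  \<open>\<Phi>\<close> along \<open>b\<close> with \<open>e1\<close> forces \<open>a \<ge> 1 - s\<close>, while \<open>|y\<^sub>n d(n)| \<le> 2 (1 - s) n\<close>. In both cases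
  \<open>|b(t) d(t)| \<le> (2 - \<kappa>) t\<close> for some \<open>\<kappa> > 0\<close>.
\<close>

section \<open>Geodesics in Busemann spaces\<close>

text \<open>Values outside \<open>[0, l]\<close> are unconstrained, so one function serves as a
  segment of every smaller length; \<open>l = 0\<close> admits single points.\<close>

definition unit_speed :: "(real \<Rightarrow> 'a::metric_space) \<Rightarrow> real \<Rightarrow> bool" where
  "unit_speed \<gamma> l \<longleftrightarrow> 0 \<le> l \<and> (\<forall>s\<in>{0..l}. \<forall>t\<in>{0..l}. dist (\<gamma> s) (\<gamma> t) = \<bar>s - t\<bar>)"

lemma unit_speedD:
  "unit_speed \<gamma> l \<Longrightarrow> 0 \<le> s \<Longrightarrow> s \<le> l \<Longrightarrow> 0 \<le> t \<Longrightarrow> t \<le> l \<Longrightarrow> dist (\<gamma> s) (\<gamma> t) = \<bar>s - t\<bar>"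
  by (auto simp: unit_speed_def)

lemma unit_speed_nonneg: "unit_speed \<gamma> l \<Longrightarrow> 0 \<le> l"
  by (simp add: unit_speed_def)

lemma unit_speed_dist0: "unit_speed \<gamma> l \<Longrightarrow> 0 \<le> t \<Longrightarrow> t \<le> l \<Longrightarrow> dist (\<gamma> 0) (\<gamma> t) = t"
  using unit_speedD[of \<gamma> l 0 t] by simp

lemma unit_speed_const: "unit_speed (\<lambda>_. x) 0"
  by (simp add: unit_speed_def)

lemma geodesic_space_ex_unit_speed:
  assumes "geodesic_space TYPE('a::metric_space)"
  obtains \<gamma> where "unit_speed \<gamma> (dist x y)" "\<gamma> 0 = x" "\<gamma> (dist x y) = (y::'a)"
  using assms unfolding geodesic_space_def unit_speed_def by (meson zero_le_dist)

lemma busemann_imp_geodesic: "busemann_space TYPE('a::metric_space) \<Longrightarrow> geodesic_space TYPE('a)"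
  by (simp add: busemann_space_def)

text \<open>Joint convexity is used only along the diagonal of the rectangle, from
  \<open>(0, 0)\<close> to \<open>(a, b)\<close>.\<close>

lemma busemann_convex:
  assumes bs: "busemann_space TYPE('a::metric_space)"
    and g: "unit_speed (\<gamma>::real \<Rightarrow> 'a) a" and h: "unit_speed \<gamma>' b"
    and u: "0 \<le> u" "u \<le> 1"
  shows "dist (\<gamma> (u * a)) (\<gamma>' (u * b)) \<le> (1 - u) * dist (\<gamma> 0) (\<gamma>' 0) + u * dist (\<gamma> a) (\<gamma>' b)"
proof -
  have "affine_geodesic 0 a \<gamma>" "affine_geodesic 0 b \<gamma>'"
    using g h unfolding affine_geodesic_def unit_speed_def by (auto intro!: exI[of _ 1])
  then have "convex_on ({0..a} \<times> {0..b}) (\<lambda>(t, t'). dist (\<gamma> t) (\<gamma>' t'))"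
    using bs unfolding busemann_space_def by blast
  from convex_onD[OF this u, of "(0,0)" "(a,b)"] show ?thesis
    using unit_speed_nonneg[OF g] unit_speed_nonneg[OF h] by simp
qed

lemma busemann_contract:
  assumes "busemann_space TYPE('a::metric_space)"
    and "unit_speed (\<gamma>::real \<Rightarrow> 'a) a" and "unit_speed \<gamma>' b" "\<gamma> 0 = \<gamma>' 0"
    and "0 \<le> u" "u \<le> 1"
  shows "dist (\<gamma> (u * a)) (\<gamma>' (u * b)) \<le> u * dist (\<gamma> a) (\<gamma>' b)"
  using busemann_convex[OF assms(1-3,5-6)] assms(4) by simp

text \<open>The two points share their arc length, not their ratio. Convexity handles
  \<open>\<gamma> (t / m * l)\<close>; sliding from there to \<open>\<gamma> t\<close> costs
  \<open>t / m * \<bar>l - m\<bar>\<close>.\<close>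

lemma busemann_compare:
  assumes bs: "busemann_space TYPE('a::metric_space)"
    and g: "unit_speed (\<gamma>::real \<Rightarrow> 'a) l" and h: "unit_speed \<gamma>' m"
    and t: "0 \<le> t" "t \<le> l" "t \<le> m" and m: "0 < m"
  shows "dist (\<gamma> t) (\<gamma>' t) \<le> (1 - t / m) * dist (\<gamma> 0) (\<gamma>' 0) + t / m * (dist (\<gamma> l) (\<gamma>' m) + \<bar>l - m\<bar>)"
proof -
  have "dist (\<gamma> (t / m * l)) (\<gamma>' (t / m * m)) \<le> (1 - t / m) * dist (\<gamma> 0) (\<gamma>' 0) + t / m * dist (\<gamma> l) (\<gamma>' m)"
    using t m by (intro busemann_convex[OF bs g h]) auto
  moreover have "dist (\<gamma> t) (\<gamma> (t / m * l)) = \<bar>t - t / m * l\<bar>"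
    using t m mult_right_mono[of "t / m" 1 l] by (intro unit_speedD[OF g]) auto
  moreover have "\<bar>t - t / m * l\<bar> = t / m * \<bar>l - m\<bar>"
  proof -
    have "t - t / m * l = t / m * (m - l)" using m by (simp add: field_simps)
    then show ?thesis using t m by (simp add: abs_mult abs_minus_commute)
  qed
  ultimately show ?thesis
    using m dist_triangle[of "\<gamma> t" "\<gamma>' t" "\<gamma> (t / m * l)"] by (simp add: distrib_left)
qed

lemma busemann_convex_dist:
  assumes "busemann_space TYPE('a::metric_space)"
    and "unit_speed (\<gamma>::real \<Rightarrow> 'a) a" and "0 \<le> u" "u \<le> 1"
  shows "dist q (\<gamma> (u * a)) \<le> (1 - u) * dist q (\<gamma> 0) + u * dist q (\<gamma> a)"
  using busemann_convex[OF assms(1) unit_speed_const[of q] assms(2-4)] by simp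

text \<open>Joining segments from \<open>\<gamma> 0\<close> to \<open>z\<close> and from
  \<open>z\<close> to \<open>\<gamma> l\<close> gives a second geodesic with the same ends, and
  contraction forces the two to agree.\<close>

lemma busemann_geodesic_unique:
  assumes bs: "busemann_space TYPE('a::metric_space)"
    and g: "unit_speed (\<gamma>::real \<Rightarrow> 'a) l" and s: "0 \<le> s" "s \<le> l"
    and z: "dist (\<gamma> 0) z \<le> s" "dist z (\<gamma> l) \<le> l - s"
  shows "z = \<gamma> s"
proof -
  have "dist (\<gamma> 0) (\<gamma> l) = l" using unit_speed_dist0[OF g, of l] s by simp
  then have d0: "dist (\<gamma> 0) z = s" and d1: "dist z (\<gamma> l) = l - s"
    using z dist_triangle[of "\<gamma> 0" "\<gamma> l" z] by linarith+
  have gs: "geodesic_space TYPE('a)" using bs by (rule busemann_imp_geodesic)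
  obtain \<alpha> where \<alpha>: "unit_speed \<alpha> s" "\<alpha> 0 = \<gamma> 0" "\<alpha> s = z"
    using geodesic_space_ex_unit_speed[OF gs, of "\<gamma> 0" z] d0 by metis
  obtain \<beta> where \<beta>: "unit_speed \<beta> (l - s)" "\<beta> 0 = z" "\<beta> (l - s) = \<gamma> l"
    using geodesic_space_ex_unit_speed[OF gs, of z "\<gamma> l"] d1 by metis
  define \<delta> where "\<delta> t = (if t \<le> s then \<alpha> t else \<beta> (t - s))" for t
  have le: "dist (\<delta> t) (\<delta> t') \<le> t' - t" if "0 \<le> t" "t \<le> t'" "t' \<le> l" for t t'
  proof -
    consider "t' \<le> s" | "s < t" | "t \<le> s" "s < t'" by linarith
    then show ?thesis
    proof cases
      case 1 then show ?thesis using that unit_speedD[OF \<alpha>(1), of t t'] by (simp add: \<delta>_def)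
    next
      case 2 then show ?thesis using that unit_speedD[OF \<beta>(1), of "t - s" "t' - s"] by (simp add: \<delta>_def)
    next
      case 3
      have "dist (\<alpha> t) z = s - t" using unit_speedD[OF \<alpha>(1), of t s] \<alpha>(3) 3 that s by simp
      moreover have "dist z (\<beta> (t' - s)) = t' - s"
        using unit_speed_dist0[OF \<beta>(1), of "t' - s"] \<beta>(2) 3 that by simp
      ultimately show ?thesis using 3 dist_triangle[of "\<alpha> t" "\<beta> (t' - s)" z] by (simp add: \<delta>_def)
    qed
  qed
  have ends: "\<delta> 0 = \<gamma> 0" "\<delta> s = z" "\<delta> l = \<gamma> l"
    using \<alpha> \<beta> s by (auto simp: \<delta>_def)
  \<comment> \<open>A path that never stretches distances and has ends \<open>l\<close> apart cannot
    shorten any piece either.\<close>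
  have eq: "dist (\<delta> t) (\<delta> t') = t' - t" if "0 \<le> t" "t \<le> t'" "t' \<le> l" for t t'
  proof -
    have "l \<le> dist (\<delta> 0) (\<delta> t) + dist (\<delta> t) (\<delta> t') + dist (\<delta> t') (\<delta> l)"
      using dist_triangle[of "\<delta> 0" "\<delta> l" "\<delta> t"] dist_triangle[of "\<delta> t" "\<delta> l" "\<delta> t'"] ends
        \<open>dist (\<gamma> 0) (\<gamma> l) = l\<close> by simp
    then show ?thesis using le[of 0 t] le[of t t'] le[of t' l] that by simp
  qed
  have "unit_speed \<delta> l"
    unfolding unit_speed_def
  proof (intro conjI ballI)
    show "0 \<le> l" using s by simp
    fix t t' assume "t \<in> {0..l}" "t' \<in> {0..l}"
    then show "dist (\<delta> t) (\<delta> t') = \<bar>t - t'\<bar>"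
      using eq[of t t'] eq[of t' t] by (cases "t \<le> t'") (auto simp: dist_commute)
  qed
  show ?thesis
  proof (cases "l = 0")
    case True then show ?thesis using d0 s by auto
  next
    case False
    then have "dist (\<delta> (s / l * l)) (\<gamma> (s / l * l)) \<le> s / l * dist (\<delta> l) (\<gamma> l)"
      using busemann_contract[OF bs \<open>unit_speed \<delta> l\<close> g, of "s / l"] s ends by simp
    then show ?thesis using False ends by simp
  qed
qed


section \<open>Rays and the geodesic boundary\<close>

lemma rays_unit_speed: "c \<in> rays \<Longrightarrow> 0 \<le> l \<Longrightarrow> unit_speed c l"
  by (auto simp: rays_def unit_speed_def)

lemma rays_dist: "c \<in> rays \<Longrightarrow> 0 \<le> s \<Longrightarrow> 0 \<le> t \<Longrightarrow> dist (c s) (c t) = \<bar>s - t\<bar>"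
  by (auto simp: rays_def)

lemma rays_dist0: "c \<in> rays \<Longrightarrow> 0 \<le> t \<Longrightarrow> dist (c 0) (c t) = t"
  using rays_dist[of c 0 t] by simp

lemma rays_eqI:
  assumes "c \<in> rays" "d \<in> rays" "\<And>t. 0 \<le> t \<Longrightarrow> c t = d t"
  shows "c = d"
  using assms by (intro extensionalityI[of c "{0..}" d]) (auto simp: rays_def)

text \<open>Hausdorff closeness pairs \<open>c t\<close> with some \<open>d t'\<close>. Comparing
  distances to the origins bounds \<open>\<bar>t - t'\<bar>\<close>, so passing to equal times loses
  only a bounded amount.\<close>

lemma asymptotic_iff:
  "(c, d) \<in> asymptotic \<longleftrightarrow> c \<in> rays \<and> d \<in> rays \<and> (\<exists>B. \<forall>t\<ge>0. dist (c t) (d t) \<le> B)"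
proof (intro iffI conjI; (elim conjE exE)?)
  assume a: "(c, d) \<in> asymptotic"
  then show c: "c \<in> rays" and d: "d \<in> rays" by (auto simp: asymptotic_def)
  define S where "S = (SUP x\<in>c ` {0..}. INF y\<in>d ` {0..}. ennreal (dist x y))"
  have "S < \<infinity>" using a unfolding S_def asymptotic_def hausdorff_distance_def by auto
  \<comment> \<open>The infimum need not be attained; a strict bound \<open>M\<close> still yields
    an actual point of \<open>d\<close>.\<close>
  then obtain M where M: "S < ennreal M" "0 \<le> M"
    by (cases S) (auto simp: ennreal_less_iff intro: that[of "enn2real S + 1"])
  show "\<exists>B. \<forall>t\<ge>0. dist (c t) (d t) \<le> B"
  proof (intro exI allI impI)
    fix t :: real assume t: "0 \<le> t"
    have "(INF y\<in>d ` {0..}. ennreal (dist (c t) y)) \<le> S"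
      unfolding S_def using t by (intro SUP_upper) auto
    then have "(INF y\<in>d ` {0..}. ennreal (dist (c t) y)) < ennreal M" using M by simp
    then obtain t' where t': "0 \<le> t'" "dist (c t) (d t') < M"
      by (auto simp: INF_less_iff ennreal_less_iff)
    have "\<bar>t - t'\<bar> \<le> dist (c t) (d t') + dist (c 0) (d 0)"
      using rays_dist0[OF c t] rays_dist0[OF d t'(1)]
        dist_triangle[of "c 0" "c t" "d 0"] dist_triangle[of "d 0" "c t" "d t'"]
        dist_triangle[of "d 0" "d t'" "c 0"] dist_triangle[of "c 0" "d t'" "c t"]
      by (simp add: dist_commute)
    then show "dist (c t) (d t) \<le> 2 * M + dist (c 0) (d 0)"
      using t' rays_dist[OF d t'(1) t] dist_triangle[of "c t" "d t" "d t'"] by linarith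
  qed
next
  fix B assume c: "c \<in> rays" and d: "d \<in> rays" and B: "\<forall>t\<ge>0. dist (c t) (d t) \<le> B"
  have "(SUP x\<in>c ` {0..}. INF y\<in>d ` {0..}. ennreal (dist x y)) \<le> ennreal B"
  proof (rule SUP_least)
    fix x assume "x \<in> c ` {0..}"
    then obtain t where t: "0 \<le> t" "x = c t" by auto
    show "(INF y\<in>d ` {0..}. ennreal (dist x y)) \<le> ennreal B"
      using t B by (intro INF_lower2[of "d t"]) (auto intro: ennreal_leI)
  qed
  moreover have "(SUP y\<in>d ` {0..}. INF x\<in>c ` {0..}. ennreal (dist x y)) \<le> ennreal B"
  proof (rule SUP_least)
    fix y assume "y \<in> d ` {0..}"
    then obtain t where t: "0 \<le> t" "y = d t" by auto
    show "(INF x\<in>c ` {0..}. ennreal (dist x y)) \<le> ennreal B"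
      using t B by (intro INF_lower2[of "c t"]) (auto intro: ennreal_leI)
  qed
  ultimately have "hausdorff_distance (c ` {0..}) (d ` {0..}) \<le> ennreal B"
    by (simp add: hausdorff_distance_def)
  also have "\<dots> < \<infinity>" by simp
  finally show "(c, d) \<in> asymptotic" using c d by (simp add: asymptotic_def)
qed

lemma equiv_asymptotic: "equiv rays asymptotic"
proof (rule equivI)
  show "asymptotic \<subseteq> (rays::(real \<Rightarrow> 'a) set) \<times> rays" by (auto simp: asymptotic_iff)
  show "refl_on rays (asymptotic::((real \<Rightarrow> 'a) \<times> _) set)"
    by (auto simp: refl_on_def asymptotic_iff)
  show "sym (asymptotic::((real \<Rightarrow> 'a) \<times> _) set)"
    by (auto simp: sym_def asymptotic_iff dist_commute)
  show "trans (asymptotic::((real \<Rightarrow> 'a) \<times> _) set)"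
  proof (rule transI)
    fix c d e :: "real \<Rightarrow> 'a" assume "(c, d) \<in> asymptotic" "(d, e) \<in> asymptotic"
    then obtain A B where "c \<in> rays" "e \<in> rays" "\<forall>t\<ge>0. dist (c t) (d t) \<le> A" "\<forall>t\<ge>0. dist (d t) (e t) \<le> B"
      by (auto simp: asymptotic_iff)
    moreover from this have "\<forall>t\<ge>0. dist (c t) (e t) \<le> A + B"
      by (meson add_mono dist_triangle order_trans)
    ultimately show "(c, e) \<in> asymptotic" by (auto simp: asymptotic_iff)
  qed
qed

text \<open>A nonnegative convex function on the half-line that vanishes at 0 and is bounded must be
  zero.\<close>

lemma asymptotic_unique:
  assumes bs: "busemann_space TYPE('a::metric_space)"
    and cd: "(c, d::real \<Rightarrow> 'a) \<in> asymptotic" and "c 0 = d 0"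
  shows "c = d"
proof -
  obtain B where c: "c \<in> rays" and d: "d \<in> rays" and B: "\<And>t. 0 \<le> t \<Longrightarrow> dist (c t) (d t) \<le> B"
    using cd by (auto simp: asymptotic_iff)
  have "dist (c t) (d t) \<le> e" if t: "0 \<le> t" and e: "0 < e" for t e
  proof -
    \<comment> \<open>Contraction from time \<open>T\<close>, where the distance is at most
      \<open>B\<close>, then leaves at most \<open>e\<close> at time \<open>t\<close>; the
      \<open>+ 1\<close> keeps \<open>T\<close> positive.\<close>
    define T where "T = max t (t * B / e) + 1"
    have T: "t \<le> T" "0 < T" "t * B / e \<le> T" using t by (auto simp: T_def)
    have "dist (c (t / T * T)) (d (t / T * T)) \<le> t / T * dist (c T) (d T)"
      using T t by (intro busemann_contract[OF bs] rays_unit_speed c d assms) auto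
    also have "\<dots> \<le> t / T * B" using T t B[of T] by (intro mult_left_mono) auto
    also have "\<dots> \<le> e" using T e by (simp add: field_simps)
    finally show ?thesis using T by simp
  qed
  then have "dist (c t) (d t) \<le> 0" if "0 \<le> t" for t
    using that by (intro field_le_epsilon[of _ 0]) simp
  then show ?thesis using c d by (intro rays_eqI) auto
qed

text \<open>Arzela-Ascoli for segments issuing from \<open>p\<close>: properness and a diagonal
  choice give convergence at integer times, and contraction towards \<open>p\<close> carries it to
  the times in between.\<close>

lemma limit_ray:
  assumes bs: "busemann_space TYPE('a::metric_space)" and pr: "proper_space TYPE('a)"
    and P: "\<And>n. unit_speed (P n) (l n)" "\<And>n. P n 0 = (p::'a)"
    and l: "filterlim l at_top sequentially"
  obtains r c where "strict_mono (r::nat \<Rightarrow> nat)" "c \<in> rays" "c 0 = p"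
    "\<And>t. 0 \<le> t \<Longrightarrow> (\<lambda>n. P (r n) t) \<longlonglongrightarrow> c t"
proof -
  have large: "\<forall>\<^sub>F n in sequentially. x \<le> l (s n)" if "strict_mono s" for x s
    using filterlim_compose[OF l filterlim_subseq[OF that]] by (auto simp: filterlim_at_top)
  interpret subseqs "\<lambda>k s. convergent (\<lambda>n. P (s n) (real k))"
  proof
    fix k and s :: "nat \<Rightarrow> nat" assume s: "strict_mono s"
    \<comment> \<open>Beyond its length a segment is uncontrolled, so short ones are replaced by
      \<open>p\<close> to stay in the ball; this affects only finitely many
      \<open>n\<close>.\<close>
    define f where "f n = (if real k \<le> l (s n) then P (s n) (real k) else p)" for n
    have comp: "compact (cball p (real k))" using pr by (simp add: proper_space_def)
    have "\<forall>n. f n \<in> cball p (real k)"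
      using unit_speed_dist0[OF P(1)] P(2) by (auto simp: f_def)
    with comp[unfolded compact_def, rule_format, of f]
    obtain x r where r: "strict_mono r" "(f \<circ> r) \<longlonglongrightarrow> x" by auto
    have "\<forall>\<^sub>F n in sequentially. (f \<circ> r) n = P ((s \<circ> r) n) (real k)"
      using large[OF strict_mono_o[OF s r(1)], of "real k"] by eventually_elim (simp add: f_def)
    from tendsto_cong[OF this, of x] r have "(\<lambda>n. P ((s \<circ> r) n) (real k)) \<longlonglongrightarrow> x"
      by (simp add: o_def)
    then have "convergent (\<lambda>n. P ((s \<circ> r) n) (real k))" by (auto simp: convergent_def)
    then show "\<exists>r'. strict_mono r' \<and> convergent (\<lambda>n. P ((s \<circ> r') n) (real k))" using r by blast
  qed
  define r where "r = diagseq"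
  have r: "strict_mono r" unfolding r_def by (rule subseq_diagseq)
  have conv: "convergent (\<lambda>n. P (r n) (real k))" for k
  proof -
    \<comment> \<open>The diagonal sequence is known to refine the selection made for
      \<open>k\<close> only from index \<open>Suc k\<close> on; the shift is removed
      afterwards.\<close>
    have "convergent (\<lambda>n. P ((diagseq \<circ> (+) (Suc k)) n) (real k))"
    proof (rule diagseq_holds)
      fix r s :: "nat \<Rightarrow> nat" and n assume "strict_mono r" "convergent (\<lambda>i. P (s i) (real n))"
      then show "convergent (\<lambda>i. P ((s \<circ> r) i) (real n))"
        using convergent_subseq_convergent[of "\<lambda>i. P (s i) (real n)" r] by (simp add: o_def)
    qed
    then have "convergent (\<lambda>n. P (r (n + Suc k)) (real k))" by (simp add: r_def o_def add.commute)
    then obtain L where "(\<lambda>n. P (r (n + Suc k)) (real k)) \<longlonglongrightarrow> L" unfolding convergent_def ..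
    then have "(\<lambda>n. P (r n) (real k)) \<longlonglongrightarrow> L" by (rule LIMSEQ_offset)
    then show ?thesis unfolding convergent_def ..
  qed
  have ex: "\<exists>x. (\<lambda>n. P (r n) t) \<longlonglongrightarrow> x" if t: "0 \<le> t" for t
  proof -
    obtain j where "t \<le> real j" using real_arch_simple by blast
    define k where "k = Suc j"
    have k: "t \<le> real k" "0 < k" using \<open>t \<le> real j\<close> by (auto simp: k_def)
    obtain x where x: "(\<lambda>n. P (r n) (real k)) \<longlonglongrightarrow> x" using conv[of k] by (auto simp: convergent_def)
    have ev: "\<forall>\<^sub>F n in sequentially. real k \<le> l (r n)" by (rule large[OF r])
    have "(\<lambda>n. dist p (P (r n) (real k))) \<longlonglongrightarrow> dist p x" by (intro tendsto_intros x)
    moreover have "(\<lambda>n. dist p (P (r n) (real k))) \<longlonglongrightarrow> real k"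
    proof (rule tendsto_eventually, use ev in eventually_elim)
      case (elim n) then show ?case using unit_speed_dist0[OF P(1)] P(2) by auto
    qed
    ultimately have dx: "dist p x = real k" by (rule LIMSEQ_unique)
    \<comment> \<open>The segment to the limit at time \<open>k\<close> supplies the candidate limit
      at time \<open>t\<close>: contraction bounds the error at \<open>t\<close> by the error at
      \<open>k\<close>.\<close>
    obtain \<gamma> where \<gamma>: "unit_speed \<gamma> (real k)" "\<gamma> 0 = p" "\<gamma> (real k) = x"
      using geodesic_space_ex_unit_speed[OF busemann_imp_geodesic[OF bs], of p x] dx by metis
    have "(\<lambda>n. dist (P (r n) t) (\<gamma> t)) \<longlonglongrightarrow> 0"
    proof (rule tendsto_sandwich[OF _ _ tendsto_const])
      show "\<forall>\<^sub>F n in sequentially. dist (P (r n) t) (\<gamma> t) \<le> t / real k * dist (P (r n) (real k)) x"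
        using ev
      proof eventually_elim
        case (elim n)
        have "unit_speed (P (r n)) (real k)" using P(1)[of "r n"] elim by (auto simp: unit_speed_def)
        from busemann_contract[OF bs this \<gamma>(1), of "t / real k"] show ?case
          using \<gamma> P(2) k t by simp
      qed
      show "(\<lambda>n. t / real k * dist (P (r n) (real k)) x) \<longlonglongrightarrow> 0"
        using tendsto_mult_right_zero[OF tendsto_dist_iff[THEN iffD1, OF x]] by blast
    qed auto
    then show ?thesis using tendsto_dist_iff by blast
  qed
  define c where "c = restrict (\<lambda>t. SOME x. (\<lambda>n. P (r n) t) \<longlonglongrightarrow> x) {0..}"
  have c: "(\<lambda>n. P (r n) t) \<longlonglongrightarrow> c t" if "0 \<le> t" for t
    using someI_ex[OF ex[OF that]] that by (simp add: c_def)
  have "dist (c s) (c t) = \<bar>s - t\<bar>" if "0 \<le> s" "0 \<le> t" for s t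
  proof (rule LIMSEQ_unique)
    show "(\<lambda>n. dist (P (r n) s) (P (r n) t)) \<longlonglongrightarrow> dist (c s) (c t)" by (intro tendsto_intros c that)
    show "(\<lambda>n. dist (P (r n) s) (P (r n) t)) \<longlonglongrightarrow> \<bar>s - t\<bar>"
    proof (rule tendsto_eventually, use large[OF r, of "max s t"] in eventually_elim)
      case (elim n) then show ?case using that by (intro unit_speedD[OF P(1)]) auto
    qed
  qed
  then have "c \<in> rays" by (auto simp: rays_def c_def)
  moreover have "c 0 = p" using LIMSEQ_unique[OF c[of 0]] P(2) by simp
  ultimately show ?thesis using that r c by blast
qed

text \<open>Segments from \<open>p\<close> to \<open>d n\<close> have length within \<open>D\<close>
  of \<open>n\<close>, so by comparison they lie within \<open>2 * D\<close> of \<open>d\<close> at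
  each fixed time once \<open>n\<close> is large. A limit ray inherits the bound.\<close>

lemma asymptotic_ray_exists:
  assumes bs: "busemann_space TYPE('a::metric_space)" and pr: "proper_space TYPE('a)"
    and d: "(d::real \<Rightarrow> 'a) \<in> rays"
  obtains c where "(d, c) \<in> asymptotic" "c 0 = p"
proof -
  define D where "D = dist p (d 0)"
  have "\<forall>n. \<exists>\<gamma>. unit_speed \<gamma> (dist p (d (real n))) \<and> \<gamma> 0 = p \<and> \<gamma> (dist p (d (real n))) = d (real n)"
    using geodesic_space_ex_unit_speed[OF busemann_imp_geodesic[OF bs]] by metis
  then obtain P where P: "\<And>n. unit_speed (P n) (dist p (d (real n)))" "\<And>n. P n 0 = p"
      "\<And>n. P n (dist p (d (real n))) = d (real n)" by metis
  have len: "\<bar>dist p (d (real n)) - real n\<bar> \<le> D" for n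
    using rays_dist0[OF d, of "real n"] dist_triangle[of p "d (real n)" "d 0"]
      dist_triangle[of "d 0" "d (real n)" p] by (simp add: D_def dist_commute)
  have "filterlim (\<lambda>n. - D + real n) at_top sequentially"
    by (intro filterlim_tendsto_add_at_top[OF tendsto_const] filterlim_real_sequentially)
  then have lim: "filterlim (\<lambda>n. dist p (d (real n))) at_top sequentially"
    by (rule filterlim_at_top_mono) (use len in \<open>auto intro!: always_eventually simp: abs_le_iff algebra_simps\<close>)
  obtain r c where r: "strict_mono r" and c: "c \<in> rays" "c 0 = p"
      "\<And>t. 0 \<le> t \<Longrightarrow> (\<lambda>n. P (r n) t) \<longlonglongrightarrow> c t"
    using limit_ray[OF bs pr P(1,2) lim] by metis
  have "dist (d t) (c t) \<le> 2 * D" if t: "0 \<le> t" for t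
  proof (rule tendsto_upperbound)
    show "(\<lambda>n. dist (d t) (P (r n) t)) \<longlonglongrightarrow> dist (d t) (c t)" by (intro tendsto_intros c t)
    have "\<forall>\<^sub>F n in sequentially. max 1 t \<le> dist p (d (real n)) \<and> max 1 t \<le> real n"
      using filterlim_at_top[THEN iffD1, OF lim] filterlim_at_top[THEN iffD1, OF filterlim_real_sequentially]
      by (simp only: eventually_conj)
    then have "\<forall>\<^sub>F n in sequentially. dist (d t) (P n t) \<le> 2 * D"
    proof eventually_elim
      case (elim n)
      define L where "L = dist p (d (real n))"
      have n: "1 \<le> real n" "t \<le> real n" "t \<le> L" using elim by (auto simp: L_def)
      have "dist (P n t) (d t) \<le> (1 - t / real n) * dist (P n 0) (d 0)
          + t / real n * (dist (P n L) (d (real n)) + \<bar>L - real n\<bar>)"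
        using n t by (intro busemann_compare[OF bs _ rays_unit_speed[OF d]]) (auto simp: L_def intro: P(1))
      also have "\<dots> \<le> 1 * D + 1 * D"
        using P(2,3) n t len[of n] by (intro add_mono mult_mono) (auto simp: L_def D_def)
      finally show ?case by (simp add: dist_commute)
    qed
    then show "\<forall>\<^sub>F n in sequentially. dist (d t) (P (r n) t) \<le> 2 * D"
      by (rule eventually_subseq[OF r])
  qed simp
  then show ?thesis using that c d by (auto simp: asymptotic_iff)
qed

text \<open>Justifies the definite description in \<open>ray_from\<close>: existence is
  \<open>asymptotic_ray_exists\<close>, uniqueness is \<open>asymptotic_unique\<close>.\<close>

lemma ray_from:
  assumes bs: "busemann_space TYPE('a::metric_space)" and pr: "proper_space TYPE('a)"
    and xi: "\<xi> \<in> geodesic_boundary"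
  shows "ray_from (p::'a) \<xi> \<in> \<xi>" "ray_from p \<xi> 0 = p"
proof -
  obtain d where d: "d \<in> rays" "\<xi> = asymptotic `` {d}"
    using xi unfolding geodesic_boundary_def by (auto elim: quotientE)
  obtain c where "(d, c) \<in> asymptotic" "c 0 = p" using asymptotic_ray_exists[OF bs pr d(1)] .
  moreover have "c' = c''" if "c' \<in> \<xi>" "c'' \<in> \<xi>" "c' 0 = p" "c'' 0 = p" for c' c''
    using that quotient_eq_iff[OF equiv_asymptotic, of \<xi> \<xi> c' c''] xi asymptotic_unique[OF bs, of c' c'']
    by (auto simp: geodesic_boundary_def)
  ultimately have "\<exists>!c. c \<in> \<xi> \<and> c 0 = p" using d(2) by auto
  then show "ray_from p \<xi> \<in> \<xi>" "ray_from p \<xi> 0 = p"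
    unfolding ray_from_def using theI'[of "\<lambda>c. c \<in> \<xi> \<and> c 0 = p"] by auto
qed

lemma geodesic_boundary_asymptotic:
  assumes "\<xi> \<in> geodesic_boundary" "c \<in> \<xi>" "d \<in> \<xi>"
  shows "(c, d) \<in> asymptotic"
  using quotient_eq_iff[OF equiv_asymptotic, of \<xi> \<xi> c d] assms by (simp add: geodesic_boundary_def)

lemma ray_from_class:
  assumes bs: "busemann_space TYPE('a::metric_space)" and pr: "proper_space TYPE('a)"
    and c: "c \<in> rays" "c 0 = (p::'a)"
  shows "asymptotic `` {c} \<in> geodesic_boundary" "ray_from p (asymptotic `` {c}) = c"
proof -
  show b: "asymptotic `` {c} \<in> geodesic_boundary"
    using c by (simp add: geodesic_boundary_def quotientI)
  show "ray_from p (asymptotic `` {c}) = c"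
    using ray_from[OF bs pr b, of p] c asymptotic_unique[OF bs, of c "ray_from p (asymptotic `` {c})"]
    by simp
qed

text \<open>The quotient is nondecreasing by contraction towards \<open>p\<close>, and bounded, so
  it converges to its supremum. Convergence must be shown, since \<open>Lim\<close> carries no
  information for a divergent function.\<close>

lemma Td_delta_le:
  assumes bs: "busemann_space TYPE('a::metric_space)" and pr: "proper_space TYPE('a)"
    and b: "\<xi> \<in> geodesic_boundary" "\<eta> \<in> geodesic_boundary"
    and M: "\<And>t. 0 < t \<Longrightarrow> dist (ray_from (p::'a) \<xi> t) (ray_from p \<eta> t) \<le> M * t"
  shows "Td_delta p \<xi> \<eta> \<le> M / 2"
proof -
  define c d where "c = ray_from p \<xi>" and "d = ray_from p \<eta>"
  have c: "c \<in> rays" and d: "d \<in> rays" and cd0: "c 0 = p" "d 0 = p"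
    using ray_from[OF bs pr b(1), of p] ray_from[OF bs pr b(2), of p] geodesic_boundary_asymptotic b
    unfolding c_def d_def by (auto simp: asymptotic_iff)
  define q where "q t = dist (c t) (d t) / (2 * t)" for t
  have mono: "q s \<le> q t" if "0 < s" "s \<le> t" for s t
    using busemann_contract[OF bs rays_unit_speed[OF c, of t] rays_unit_speed[OF d, of t], of "s / t"]
      that cd0 by (simp add: q_def field_simps)
  have bd: "q t \<le> M / 2" if "0 < t" for t
    using M[OF that] that by (simp add: q_def c_def d_def field_simps)
  define S where "S = (SUP t\<in>{0<..}. q t)"
  have bdd: "bdd_above (q ` {0<..})" using bd by (intro bdd_aboveI[of _ "M / 2"]) auto
  have "(q \<longlongrightarrow> S) at_top"
  proof (rule increasing_tendsto)
    show "\<forall>\<^sub>F t in at_top. q t \<le> S"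
      using eventually_gt_at_top[of "0::real"]
      by eventually_elim (use bdd in \<open>auto simp: S_def intro: cSUP_upper\<close>)
    fix x assume "x < S"
    then obtain s where s: "0 < s" "x < q s"
      unfolding S_def using less_cSUP_iff[OF _ bdd, of x] by auto
    show "\<forall>\<^sub>F t in at_top. x < q t"
      using eventually_ge_at_top[of s] by eventually_elim (use mono s in \<open>force intro: less_le_trans\<close>)
  qed
  then have "Td_delta p \<xi> \<eta> = S"
    unfolding Td_delta_def q_def c_def d_def by (intro tendsto_Lim) auto
  also have "S \<le> M / 2" unfolding S_def by (rule cSUP_least) (use bd in auto)
  finally show ?thesis .
qed


section \<open>Horofunctions\<close>

text \<open>\<open>differ_by_const\<close> relates continuous functions only, so a discontinuous
  function would have an empty \<open>const_class\<close>, whereas elements of a quotient are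
  nonempty.\<close>

lemma horo_boundary_cont:
  assumes "const_class \<Phi> \<in> horo_boundary"
  shows "\<Phi> \<in> cont_functions"
proof -
  have "const_class \<Phi> \<in> topspace cont_mod_const_topology"
    using assms unfolding horo_boundary_def horo_closure_def by (auto simp: in_closure_of)
  then have "const_class \<Phi> \<in> cont_functions // differ_by_const"
    using openin_cont_mod_const_topology openin_topspace by blast
  then obtain g where "g \<in> cont_functions" "const_class \<Phi> = differ_by_const `` {g}"
    by (auto elim: quotientE)
  moreover from this have "g \<in> differ_by_const `` {g}" by (auto simp: differ_by_const_def)
  ultimately have "(\<Phi>, g) \<in> differ_by_const" by (auto simp: const_class_def)
  then show ?thesis by (simp add: differ_by_const_def)
qed

text \<open>Functions close to \<Phi> on the ball, after normalisation at \<open>p\<close>, form an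
  open union of classes. Its image is therefore an open neighbourhood of the class of \<Phi> and
  meets the embedded space.\<close>

lemma horo_boundary_approx:
  assumes \<Phi>: "const_class (\<Phi>::'a::metric_space \<Rightarrow> real) \<in> horo_boundary" and e: "0 < e"
  obtains x where "\<And>y. y \<in> cball p R \<Longrightarrow> \<bar>(dist x y - dist x p) - (\<Phi> y - \<Phi> p)\<bar> \<le> e"
proof -
  \<comment> \<open>The uniform gap \<open>e' < e\<close> makes \<open>W\<close> open; a strict
    pointwise bound could have supremum \<open>e\<close> on the ball and leave no room for
    perturbation.\<close>
  define W where "W = {f \<in> cont_functions. \<exists>e'<e. \<forall>y\<in>cball p R. \<bar>(f y - f p) - (\<Phi> y - \<Phi> p)\<bar> \<le> e'}"
  have "\<exists>B. bounded B \<and> (\<forall>\<^sub>F g in uniformly_on B f. g \<in> cont_functions \<longrightarrow> g \<in> W)" if f: "f \<in> W" for f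
  proof -
    obtain e' where e': "e' < e" "\<And>y. y \<in> cball p R \<Longrightarrow> \<bar>(f y - f p) - (\<Phi> y - \<Phi> p)\<bar> \<le> e'"
      using f unfolding W_def by blast
    \<comment> \<open>A perturbation by \<open>k\<close> enters twice, at \<open>y\<close> and at
      \<open>p\<close>. Inserting \<open>p\<close> below covers negative \<open>R\<close>.\<close>
    define k where "k = (e - e') / 4"
    have "\<forall>\<^sub>F g in uniformly_on (insert p (cball p R)) f. \<forall>y\<in>insert p (cball p R). dist (g y) (f y) < k"
      unfolding uniformly_on_def
      by (rule eventually_INF1[of k]) (use e' in \<open>auto simp: k_def eventually_principal\<close>)
    then have "\<forall>\<^sub>F g in uniformly_on (insert p (cball p R)) f. g \<in> cont_functions \<longrightarrow> g \<in> W"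
    proof eventually_elim
      case (elim g)
      have "\<bar>(g y - g p) - (\<Phi> y - \<Phi> p)\<bar> \<le> e' + 2 * k" if "y \<in> cball p R" for y
      proof -
        have "\<bar>g y - f y\<bar> < k" "\<bar>g p - f p\<bar> < k" using elim that by (auto simp: dist_real_def)
        then show ?thesis using e'(2)[OF that] by linarith
      qed
      moreover have "e' + 2 * k < e" using e'(1) by (simp add: k_def field_simps)
      ultimately show ?case unfolding W_def by blast
    qed
    then show ?thesis by (intro exI[of _ "insert p (cball p R)"]) simp
  qed
  then have "openin bounded_uniform_topology W"
    unfolding openin_bounded_uniform_topology by (auto simp: W_def)
  \<comment> \<open>Normalisation at \<open>p\<close> cancels additive constants, so
    \<open>W\<close> is saturated.\<close>
  moreover have "{f \<in> cont_functions. const_class f \<in> const_class ` W} = W"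
  proof (intro equalityI subsetI)
    fix f assume "f \<in> {f \<in> cont_functions. const_class f \<in> const_class ` W}"
    then obtain g where f: "f \<in> cont_functions" and g: "g \<in> W" "const_class f = const_class g" by auto
    have "f \<in> const_class g" using f unfolding g(2)[symmetric]
      by (auto simp: const_class_def differ_by_const_def intro: exI[of _ 0])
    then obtain k where "\<forall>x. f x = g x + k" by (auto simp: const_class_def differ_by_const_def)
    then show "f \<in> W" using g(1) f by (simp add: W_def)
  qed (auto simp: W_def)
  moreover have "const_class ` W \<subseteq> cont_functions // differ_by_const"
    by (auto simp: W_def const_class_def intro: quotientI)
  ultimately have "openin cont_mod_const_topology (const_class ` W)"
    by (simp add: openin_cont_mod_const_topology)
  moreover have "const_class \<Phi> \<in> const_class ` W"
    using horo_boundary_cont[OF \<Phi>] e by (auto simp: W_def intro!: imageI exI[of _ 0])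
  moreover have "const_class \<Phi> \<in> cont_mod_const_topology closure_of range horo_embedding"
    using \<Phi> by (simp add: horo_boundary_def horo_closure_def)
  ultimately have "\<exists>y. y \<in> range horo_embedding \<and> y \<in> const_class ` W"
    by (simp only: in_closure_of)
  then obtain x where "horo_embedding x \<in> const_class ` W" by auto
  then have "dist x \<in> {f \<in> cont_functions. const_class f \<in> const_class ` W}"
    by (auto simp: horo_embedding_def cont_functions_def intro!: continuous_intros)
  then have "dist x \<in> W" using \<open>{f \<in> cont_functions. const_class f \<in> const_class ` W} = W\<close> by simp
  then obtain e' where e': "e' < e" "\<forall>y\<in>cball p R. \<bar>(dist x y - dist x p) - (\<Phi> y - \<Phi> p)\<bar> \<le> e'"
    unfolding W_def mem_Collect_eq by (elim conjE exE)
  have "\<bar>(dist x y - dist x p) - (\<Phi> y - \<Phi> p)\<bar> \<le> e" if "y \<in> cball p R" for y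
    using e'(1) bspec[OF e'(2) that] by simp
  then show ?thesis by (rule that)
qed

text \<open>Approximation on growing balls gives pointwise convergence. If the centres returned to a
  bounded set infinitely often, properness would give a limit \<open>z\<close> with \<Phi> equal to
  \<open>dist z\<close> up to a constant, putting the class in the image of the space.\<close>

lemma horo_boundary_limit:
  assumes pr: "proper_space TYPE('a::metric_space)"
    and \<Phi>: "const_class (\<Phi>::'a \<Rightarrow> real) \<in> horo_boundary"
  obtains X where "\<And>y. (\<lambda>n. dist (X n) y - dist (X n) p) \<longlonglongrightarrow> \<Phi> y - \<Phi> p"
    "filterlim (\<lambda>n. dist p (X n)) at_top sequentially"
proof -
  have "\<forall>n. \<exists>x. \<forall>y\<in>cball p (real n). \<bar>(dist x y - dist x p) - (\<Phi> y - \<Phi> p)\<bar> \<le> inverse (real (Suc n))"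
  proof
    fix n
    have "0 < inverse (real (Suc n))" by simp
    from horo_boundary_approx[OF \<Phi> this, of p "real n"]
    show "\<exists>x. \<forall>y\<in>cball p (real n). \<bar>(dist x y - dist x p) - (\<Phi> y - \<Phi> p)\<bar> \<le> inverse (real (Suc n))"
      by metis
  qed
  then obtain X where X: "\<And>n y. y \<in> cball p (real n) \<Longrightarrow>
      \<bar>(dist (X n) y - dist (X n) p) - (\<Phi> y - \<Phi> p)\<bar> \<le> inverse (real (Suc n))" by metis
  have lim: "(\<lambda>n. dist (X n) y - dist (X n) p) \<longlonglongrightarrow> \<Phi> y - \<Phi> p" for y
  proof (rule Lim_transform_bound[THEN LIM_zero_cancel])
    obtain N :: nat where N: "dist p y \<le> real N" using real_arch_simple by blast
    show "\<forall>\<^sub>F n in sequentially. norm (dist (X n) y - dist (X n) p - (\<Phi> y - \<Phi> p)) \<le> norm (inverse (real (Suc n)))"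
      using eventually_ge_at_top[of N] by eventually_elim (use N X in \<open>auto intro!: X\<close>)
  qed (rule LIMSEQ_inverse_real_of_nat)
  have "filterlim (\<lambda>n. dist p (X n)) at_top sequentially"
  proof (rule ccontr)
    assume "\<not> ?thesis"
    then obtain Z where "\<exists>\<^sub>F n in sequentially. dist p (X n) < Z"
      by (auto simp: filterlim_at_top not_eventually not_le)
    then have "\<exists>\<^sub>F n in sequentially. dist p (X n) \<le> Z" by (rule frequently_elim1) simp
    then have "infinite {n. X n \<in> cball p Z}"
      by (simp add: frequently_cofinite flip: cofinite_eq_sequentially)
    from infinite_enumerate[OF this] obtain r :: "nat \<Rightarrow> nat"
      where r: "strict_mono r" "\<forall>n. r n \<in> {n. X n \<in> cball p Z}" by blast
    have "compact (cball p Z)" using pr by (simp add: proper_space_def)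
    from this[unfolded compact_def, rule_format, of "X \<circ> r"] r(2)
    obtain z r' where r': "strict_mono r'" "(\<lambda>n. X (r (r' n))) \<longlonglongrightarrow> z"
      by (auto simp: o_def)
    have diff: "\<Phi> y - \<Phi> p = dist z y - dist z p" for y
    proof (rule LIMSEQ_unique)
      show "(\<lambda>n. dist (X (r (r' n))) y - dist (X (r (r' n))) p) \<longlonglongrightarrow> \<Phi> y - \<Phi> p"
        using LIMSEQ_subseq_LIMSEQ[OF lim[of y] strict_mono_o[OF r(1) r'(1)]] by (simp add: o_def)
      show "(\<lambda>n. dist (X (r (r' n))) y - dist (X (r (r' n))) p) \<longlonglongrightarrow> dist z y - dist z p"
        by (intro tendsto_intros r')
    qed
    define k0 where "k0 = \<Phi> p - dist z p"
    have eq: "\<Phi> y = dist z y + k0" for y using diff[of y] by (simp add: k0_def)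
    have cont: "(\<lambda>y. dist z y) \<in> cont_functions" by (auto simp: cont_functions_def intro!: continuous_intros)
    have "(\<exists>k. \<forall>x. g x = \<Phi> x + k) \<longleftrightarrow> (\<exists>k. \<forall>x. g x = dist z x + k)" for g :: "'a \<Rightarrow> real"
    proof
      assume "\<exists>k. \<forall>x. g x = \<Phi> x + k"
      then obtain k where "\<forall>x. g x = \<Phi> x + k" by blast
      then show "\<exists>k. \<forall>x. g x = dist z x + k" by (intro exI[of _ "k0 + k"]) (simp add: eq)
    next
      assume "\<exists>k. \<forall>x. g x = dist z x + k"
      then obtain k where "\<forall>x. g x = dist z x + k" by blast
      then show "\<exists>k. \<forall>x. g x = \<Phi> x + k" by (intro exI[of _ "k - k0"]) (simp add: eq)
    qed
    then have "const_class \<Phi> = horo_embedding z"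
      using cont horo_boundary_cont[OF \<Phi>] by (simp add: const_class_def horo_embedding_def differ_by_const_def Image_def)
    then show False using \<Phi> by (auto simp: horo_boundary_def)
  qed
  with lim that show ?thesis by blast
qed

section \<open>Lipschitz bound, convexity and descent for horofunctions\<close>

lemma horo_lipschitz:
  assumes "\<And>y. (\<lambda>n. dist (X n) y - dist (X n) p) \<longlonglongrightarrow> \<Phi> y - \<Phi> (p::'a::metric_space)"
  shows "\<bar>\<Phi> x - \<Phi> y\<bar> \<le> dist x y"
proof (rule tendsto_upperbound)
  show "(\<lambda>n. \<bar>dist (X n) x - dist (X n) p - (dist (X n) y - dist (X n) p)\<bar>) \<longlonglongrightarrow> \<bar>\<Phi> x - \<Phi> y\<bar>"
    using tendsto_rabs[OF tendsto_diff[OF assms[of x] assms[of y]]] by simp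
  show "\<forall>\<^sub>F n in sequentially. \<bar>dist (X n) x - dist (X n) p - (dist (X n) y - dist (X n) p)\<bar> \<le> dist x y"
    using abs_dist_diff_le[of x "X _" y] by (intro always_eventually allI) (simp add: dist_commute[of "X _"])
qed simp

lemma horo_convex:
  assumes bs: "busemann_space TYPE('a::metric_space)"
    and lim: "\<And>y. (\<lambda>n. dist (X n) y - dist (X n) p) \<longlonglongrightarrow> \<Phi> y - \<Phi> (p::'a)"
    and g: "unit_speed \<gamma> l" and u: "0 \<le> u" "u \<le> 1"
  shows "\<Phi> (\<gamma> (u * l)) \<le> (1 - u) * \<Phi> (\<gamma> 0) + u * \<Phi> (\<gamma> l)"
proof -
  have "\<Phi> (\<gamma> (u * l)) - \<Phi> p \<le> (1 - u) * (\<Phi> (\<gamma> 0) - \<Phi> p) + u * (\<Phi> (\<gamma> l) - \<Phi> p)"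
  proof (rule tendsto_le[OF _ _ lim])
    show "(\<lambda>n. (1 - u) * (dist (X n) (\<gamma> 0) - dist (X n) p) + u * (dist (X n) (\<gamma> l) - dist (X n) p))
        \<longlonglongrightarrow> (1 - u) * (\<Phi> (\<gamma> 0) - \<Phi> p) + u * (\<Phi> (\<gamma> l) - \<Phi> p)"
      by (intro tendsto_intros lim)
    show "\<forall>\<^sub>F n in sequentially. dist (X n) (\<gamma> (u * l)) - dist (X n) p
        \<le> (1 - u) * (dist (X n) (\<gamma> 0) - dist (X n) p) + u * (dist (X n) (\<gamma> l) - dist (X n) p)"
      using busemann_convex_dist[OF bs g u] by (intro always_eventually allI) (simp add: algebra_simps)
  qed simp
  then show ?thesis by (simp add: algebra_simps)
qed

text \<open>Moving from \<open>x\<close> towards \<open>X n\<close> by \<open>s\<close> lowers the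
  distance to \<open>X n\<close> by exactly \<open>s\<close>; compactness of the ball gives a limit
  of the points reached.\<close>

lemma horo_descent:
  assumes bs: "busemann_space TYPE('a::metric_space)" and pr: "proper_space TYPE('a)"
    and lim: "\<And>y. (\<lambda>n. dist (X n) y - dist (X n) p) \<longlonglongrightarrow> \<Phi> y - \<Phi> (p::'a)"
    and far: "filterlim (\<lambda>n. dist p (X n)) at_top sequentially" and s: "0 \<le> s"
  obtains z where "dist x z \<le> s" "\<Phi> z \<le> \<Phi> x - s"
proof -
  \<comment> \<open>If \<open>X n\<close> is nearer than \<open>s\<close>, then \<open>x\<close> is
    a dummy value; as the centres escape, this happens only finitely often.\<close>
  have "\<exists>z\<in>cball x s. s \<le> dist x (X n) \<longrightarrow> dist (X n) z \<le> dist (X n) x - s" for n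
  proof (cases "s \<le> dist x (X n)")
    case True
    obtain \<gamma> where g: "unit_speed \<gamma> (dist x (X n))" "\<gamma> 0 = x" "\<gamma> (dist x (X n)) = X n"
      using geodesic_space_ex_unit_speed[OF busemann_imp_geodesic[OF bs]] by metis
    have "dist (\<gamma> s) (X n) = dist x (X n) - s"
      using unit_speedD[OF g(1), of s "dist x (X n)"] g(3) True s by simp
    moreover have "dist x (\<gamma> s) = s" using unit_speed_dist0[OF g(1) s True] g(2) by simp
    ultimately show ?thesis by (intro bexI[of _ "\<gamma> s"]) (simp_all add: dist_commute)
  next
    case False then show ?thesis using s by (intro bexI[of _ x]) auto
  qed
  then obtain Z where Z: "\<And>n. Z n \<in> cball x s" "\<And>n. s \<le> dist x (X n) \<Longrightarrow> dist (X n) (Z n) \<le> dist (X n) x - s"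
    by metis
  have "compact (cball x s)" using pr by (simp add: proper_space_def)
  then obtain z r where z: "z \<in> cball x s" and r: "strict_mono r" "(\<lambda>n. Z (r n)) \<longlonglongrightarrow> z"
    using Z(1) unfolding compact_def o_def by metis
  have "\<Phi> z - \<Phi> p \<le> 0 + (\<Phi> x - \<Phi> p) - s"
  proof (rule tendsto_le)
    show "(\<lambda>n. dist (X (r n)) z - dist (X (r n)) p) \<longlonglongrightarrow> \<Phi> z - \<Phi> p"
      using LIMSEQ_subseq_LIMSEQ[OF lim[of z] r(1)] by (simp add: o_def)
    \<comment> \<open>Convergence to \<Phi> is pointwise while \<open>Z (r n)\<close> varies;
      replacing it by its limit \<open>z\<close> costs a distance that vanishes.\<close>
    have "(\<lambda>n. dist (Z (r n)) z) \<longlonglongrightarrow> 0" by (rule tendsto_dist_iff[THEN iffD1, OF r(2)])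
    then show "(\<lambda>n. dist (Z (r n)) z + (dist (X (r n)) x - dist (X (r n)) p) - s) \<longlonglongrightarrow> 0 + (\<Phi> x - \<Phi> p) - s"
      using LIMSEQ_subseq_LIMSEQ[OF lim[of x] r(1)]
      by (intro tendsto_diff[OF tendsto_add tendsto_const]) (simp_all add: o_def)
    have "\<forall>\<^sub>F n in sequentially. s + dist p x \<le> dist p (X (r n))"
      using eventually_subseq[OF r(1)] far by (auto simp: filterlim_at_top)
    then show "\<forall>\<^sub>F n in sequentially. dist (X (r n)) z - dist (X (r n)) p
        \<le> dist (Z (r n)) z + (dist (X (r n)) x - dist (X (r n)) p) - s"
    proof eventually_elim
      case (elim n)
      then have "s \<le> dist x (X (r n))" using dist_triangle[of p "X (r n)" x] by simp
      from Z(2)[OF this] show ?case using dist_triangle[of "X (r n)" z "Z (r n)"] by simp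
    qed
  qed simp
  then show ?thesis using that z by simp
qed

text \<open>Every ray of the class stays at bounded distance from the given one, so the Lipschitz
  estimate bounds \<Phi> above on it; a convex function bounded above on a half-line never exceeds
  its initial value.\<close>

lemma horo_nonincreasing_ray:
  assumes bs: "busemann_space TYPE('a::metric_space)"
    and lim: "\<And>y. (\<lambda>n. dist (X n) y - dist (X n) p) \<longlonglongrightarrow> \<Phi> y - \<Phi> (p::'a)"
    and Td: "Td_horo_le_half_pi (const_class \<Phi>) \<xi>" and xi: "\<xi> \<in> geodesic_boundary"
    and c: "c \<in> \<xi>" and t: "0 \<le> t"
  shows "\<Phi> (c t) \<le> \<Phi> (c 0)"
proof -
  obtain \<Psi> d where d: "\<Psi> \<in> const_class \<Phi>" "d \<in> \<xi>" "antimono_on {0..} (\<Psi> \<circ> d)"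
    using Td unfolding Td_horo_le_half_pi_def by blast
  obtain k where k: "\<And>x. \<Psi> x = \<Phi> x + k" using d(1) by (auto simp: const_class_def differ_by_const_def)
  obtain B where cr: "c \<in> rays" and B: "\<And>t. 0 \<le> t \<Longrightarrow> dist (c t) (d t) \<le> B"
    using geodesic_boundary_asymptotic[OF xi c d(2)] by (auto simp: asymptotic_iff)
  have bd: "\<Phi> (c T) \<le> \<Phi> (d 0) + B" if "0 \<le> T" for T
    using monotone_onD[OF d(3), of 0 T] that horo_lipschitz[OF lim, of "c T" "d T"] B[OF that]
    by (simp add: k)
  have "\<Phi> (c t) \<le> \<Phi> (c 0) + e" if e: "0 < e" for e
  proof -
    define M where "M = \<bar>\<Phi> (d 0) + B - \<Phi> (c 0)\<bar>"
    define T where "T = t + t * M / e + 1"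
    have tM: "0 \<le> t * M / e" using t e by (simp add: M_def)
    then have T: "t \<le> T" "0 < T" "t * M / e \<le> T" using t by (auto simp: T_def)
    have "\<Phi> (c (t / T * T)) \<le> (1 - t / T) * \<Phi> (c 0) + t / T * \<Phi> (c T)"
      using T t by (intro horo_convex[OF bs lim] rays_unit_speed cr) auto
    also have "\<dots> = \<Phi> (c 0) + t / T * (\<Phi> (c T) - \<Phi> (c 0))" by (simp add: algebra_simps)
    also have "\<dots> \<le> \<Phi> (c 0) + t / T * M"
      using bd[of T] T t by (intro add_left_mono mult_left_mono) (auto simp: M_def)
    also have "\<dots> \<le> \<Phi> (c 0) + e" using T e by (simp add: field_simps)
    finally show ?thesis using T by simp
  qed
  then show ?thesis by (rule field_le_epsilon)
qed


section \<open>Tilting rays\<close>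

text \<open>First tilt: pushing \<open>c (N n)\<close> down by \<open>\<mu> * N n\<close> moves it
  by a small proportion of \<open>N n\<close>, yet turns a merely nonpositive \<Phi> into linear
  decay that survives in the limit ray.\<close>

lemma exists_descending_ray:
  assumes bs: "busemann_space TYPE('a::metric_space)" and pr: "proper_space TYPE('a)"
    and cont: "continuous_on UNIV (\<Phi>::'a \<Rightarrow> real)"
    and conv: "\<And>\<gamma> l u. unit_speed \<gamma> l \<Longrightarrow> 0 \<le> u \<Longrightarrow> u \<le> 1 \<Longrightarrow> \<Phi> (\<gamma> (u * l)) \<le> (1 - u) * \<Phi> (\<gamma> 0) + u * \<Phi> (\<gamma> l)"
    and desc: "\<And>x s. 0 \<le> s \<Longrightarrow> \<exists>z. dist x z \<le> s \<and> \<Phi> z \<le> \<Phi> x - s"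
    and p: "\<Phi> p = 0"
    and c: "c \<in> rays" "c 0 = p" "\<And>t. 0 \<le> t \<Longrightarrow> \<Phi> (c t) \<le> 0"
    and K: "0 < K" and \<delta>: "0 < \<delta>"
  obtains b e where "b \<in> rays" "b 0 = p" "0 < e" "\<And>t. 0 \<le> t \<Longrightarrow> \<Phi> (b t) \<le> - e * t" "dist (b K) (c K) \<le> \<delta>"
proof -
  \<comment> \<open>The bound \<open>1 / 2\<close> keeps \<open>y n\<close> linearly far from
    \<open>p\<close>. The other controls the error at time \<open>K\<close>: end points and lengths
    each contribute a displacement of \<open>\<mu> * N n\<close>.\<close>
  define \<mu> where "\<mu> = min (1 / 2) (\<delta> / (2 * K))"
  have \<mu>: "0 < \<mu>" "\<mu> \<le> 1 / 2" "2 * \<mu> * K \<le> \<delta>"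
    using K \<delta> by (auto simp: \<mu>_def min_def field_simps)
  define N where "N n = real (Suc n)" for n
  have N: "0 < N n" for n by (simp add: N_def)
  have "\<exists>z. dist (c (N n)) z \<le> \<mu> * N n \<and> \<Phi> z \<le> \<Phi> (c (N n)) - \<mu> * N n" for n
    using N \<mu> by (intro desc) (simp add: less_imp_le)
  then obtain y where y: "\<And>n. dist (c (N n)) (y n) \<le> \<mu> * N n" "\<And>n. \<Phi> (y n) \<le> \<Phi> (c (N n)) - \<mu> * N n"
    by metis
  have \<Phi>y: "\<Phi> (y n) \<le> - \<mu> * N n" for n using y(2)[of n] c(3)[of "N n"] N[of n] by simp
  define l where "l n = dist p (y n)" for n
  have lN: "\<bar>l n - N n\<bar> \<le> \<mu> * N n" for n
    using y(1)[of n] rays_dist0[OF c(1), of "N n"] N[of n] c(2) dist_triangle[of p "y n" "c (N n)"]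
      dist_triangle[of p "c (N n)" "y n"] by (simp add: l_def dist_commute abs_le_iff)
  have lge: "N n / 2 \<le> l n" for n
    using lN[of n] mult_right_mono[OF \<mu>(2), of "N n"] N[of n] by linarith
  have lle: "l n \<le> (1 + \<mu>) * N n" for n
    using lN[of n] by (simp add: abs_le_iff algebra_simps)
  have "\<forall>n. \<exists>\<gamma>. unit_speed \<gamma> (l n) \<and> \<gamma> 0 = p \<and> \<gamma> (l n) = y n"
    unfolding l_def using geodesic_space_ex_unit_speed[OF busemann_imp_geodesic[OF bs]] by metis
  then obtain P where P: "\<And>n. unit_speed (P n) (l n)" "\<And>n. P n 0 = p" "\<And>n. P n (l n) = y n" by metis
  have limN: "filterlim N at_top sequentially"
    unfolding N_def using filterlim_compose[OF filterlim_real_sequentially filterlim_Suc] .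
  have "filterlim (\<lambda>n. 1 / 2 * N n) at_top sequentially"
    by (rule filterlim_tendsto_pos_mult_at_top[OF tendsto_const _ limN]) simp
  then have liml: "filterlim l at_top sequentially"
    by (rule filterlim_at_top_mono) (use lge in auto)
  obtain r b where r: "strict_mono r" and b: "b \<in> rays" "b 0 = p"
      "\<And>t. 0 \<le> t \<Longrightarrow> (\<lambda>n. P (r n) t) \<longlonglongrightarrow> b t"
    using limit_ray[OF bs pr P(1,2) liml] by metis
  have ev: "\<forall>\<^sub>F n in sequentially. t \<le> l (r n) \<and> t \<le> N (r n)" for t
    using filterlim_at_top[THEN iffD1, OF liml] filterlim_at_top[THEN iffD1, OF limN]
    by (intro eventually_conj eventually_subseq[OF r]) auto
  \<comment> \<open>The drop is at least \<open>\<mu> * N n\<close> over a length of at most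
    \<open>(1 + \<mu>) * N n\<close>.\<close>
  define e where "e = \<mu> / (1 + \<mu>)"
  have "\<Phi> (b t) \<le> - e * t" if t: "0 \<le> t" for t
  proof (rule tendsto_upperbound)
    show "(\<lambda>n. \<Phi> (P (r n) t)) \<longlonglongrightarrow> \<Phi> (b t)"
      using continuous_on_tendsto_compose[OF cont b(3)[OF t]] by simp
    show "\<forall>\<^sub>F n in sequentially. \<Phi> (P (r n) t) \<le> - e * t"
      using ev[of t]
    proof eventually_elim
      case (elim n)
      define m where "m = r n"
      have m: "t \<le> l m" "0 < l m" using elim lge[of m] N[of m] by (auto simp: m_def)
      have "\<Phi> (P m (t / l m * l m)) \<le> (1 - t / l m) * \<Phi> (P m 0) + t / l m * \<Phi> (P m (l m))"
        using m t by (intro conv P) auto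
      also have "\<dots> = t / l m * \<Phi> (y m)" using P p by simp
      also have "\<dots> \<le> t / l m * (- \<mu> * N m)" using \<Phi>y[of m] m t by (intro mult_left_mono) auto
      also have "\<dots> = - \<mu> * t * (N m / l m)" by simp
      also have "\<dots> \<le> - \<mu> * t * (1 / (1 + \<mu>))"
        using lle[of m] m \<mu> t by (intro mult_left_mono_neg) (auto simp: field_simps)
      also have "\<dots> = - e * t" by (simp add: e_def)
      finally show ?case using m by (simp add: m_def)
    qed
  qed simp
  moreover have "dist (b K) (c K) \<le> \<delta>"
  proof (rule tendsto_upperbound)
    show "(\<lambda>n. dist (P (r n) K) (c K)) \<longlonglongrightarrow> dist (b K) (c K)" using K by (intro tendsto_intros b) simp
    show "\<forall>\<^sub>F n in sequentially. dist (P (r n) K) (c K) \<le> \<delta>"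
      using ev[of K]
    proof eventually_elim
      case (elim n)
      define m where "m = r n"
      have m: "K \<le> l m" "K \<le> N m" using elim by (auto simp: m_def)
      have "dist (P m K) (c K) \<le> (1 - K / N m) * dist (P m 0) (c 0)
          + K / N m * (dist (P m (l m)) (c (N m)) + \<bar>l m - N m\<bar>)"
        using K N[of m] m by (intro busemann_compare[OF bs P(1) rays_unit_speed[OF c(1)]]) auto
      also have "\<dots> = K / N m * (dist (c (N m)) (y m) + \<bar>l m - N m\<bar>)"
        using P(2,3) c(2) by (simp add: dist_commute)
      also have "\<dots> \<le> K / N m * (\<mu> * N m + \<mu> * N m)"
        using y(1)[of m] lN[of m] K N[of m] by (intro mult_left_mono add_mono) auto
      also have "\<dots> = 2 * \<mu> * K" using N[of m] by (simp add: field_simps)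
      finally show ?case using \<mu>(3) by (simp add: m_def)
    qed
  qed simp
  moreover have "0 < e" using \<mu> by (simp add: e_def)
  ultimately show ?thesis using that b by blast
qed

text \<open>Second tilt. The length \<open>L n \<le> 2 * N n\<close> is a budget shared by the two
  parts into which \<open>y n\<close> cuts the segment: what is used up on the side of
  \<open>c\<close> is saved on the side of \<open>d\<close>.\<close>

lemma exists_close_ray_delta_less:
  assumes bs: "busemann_space TYPE('a::metric_space)" and pr: "proper_space TYPE('a)"
    and lip: "\<And>x y. \<bar>\<Phi> x - \<Phi> y\<bar> \<le> dist x (y::'a)"
    and conv: "\<And>\<gamma> l u. unit_speed \<gamma> l \<Longrightarrow> 0 \<le> u \<Longrightarrow> u \<le> 1 \<Longrightarrow> \<Phi> (\<gamma> (u * l)) \<le> (1 - u) * \<Phi> (\<gamma> 0) + u * \<Phi> (\<gamma> l)"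
    and p: "\<Phi> p = (0::real)"
    and c: "c \<in> rays" "c 0 = p" and e: "0 < e" "\<And>t. 0 \<le> t \<Longrightarrow> \<Phi> (c t) \<le> - e * t"
    and d: "d \<in> rays" "d 0 = p" "\<And>t. 0 \<le> t \<Longrightarrow> \<Phi> (d t) \<le> 0"
    and K: "0 < K" and \<delta>: "0 < \<delta>"
  obtains b \<kappa> where "b \<in> rays" "b 0 = p" "0 < \<kappa>" "dist (b K) (c K) \<le> \<delta>"
    "\<And>t. 0 < t \<Longrightarrow> dist (b t) (d t) \<le> (2 - \<kappa>) * t"
proof -
  have "1-lipschitz_on UNIV \<Phi>" using lip by (intro lipschitz_onI) (auto simp: dist_real_def)
  then have cont: "continuous_on UNIV \<Phi>" by (rule lipschitz_on_continuous_on)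
  \<comment> \<open>By convexity the quotient is nonincreasing, so the infimum is the asymptotic
    rate of decrease. It is used both as a lower bound and as the greatest one.\<close>
  define e1 where "e1 = (INF t\<in>{0<..}. - \<Phi> (c t) / t)"
  have e_le: "e \<le> - \<Phi> (c t) / t" if "0 < t" for t
    using e(2)[of t] that by (simp add: field_simps)
  have bdd: "bdd_below ((\<lambda>t. - \<Phi> (c t) / t) ` {0<..})"
    using e_le by (intro bdd_belowI[of _ e]) auto
  have "e \<le> e1" unfolding e1_def using e_le by (intro cINF_greatest) auto
  then have e1: "0 < e1" using e(1) by simp
  have \<Phi>c: "\<Phi> (c t) \<le> - e1 * t" if "0 < t" for t
    using cINF_lower[OF bdd, of t] that by (simp add: e1_def field_simps)
  \<comment> \<open>In the comparison with \<open>c\<close>, end points and lengths each contribute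
    at most \<open>2 * s * N n\<close>, whence \<open>4 * s * K \<le> \<delta>\<close>.\<close>
  define s where "s = min (1 / 4) (\<delta> / (4 * K))"
  have s: "0 < s" "s \<le> 1 / 4" "4 * s * K \<le> \<delta>"
    using K \<delta> by (auto simp: s_def min_def field_simps)
  define N where "N n = real (Suc n)" for n
  have N: "0 < N n" for n by (simp add: N_def)
  define L where "L n = dist (c (N n)) (d (N n))" for n
  have L: "0 \<le> L n" "L n \<le> 2 * N n" for n
    using rays_dist0[OF c(1), of "N n"] rays_dist0[OF d(1), of "N n"] N[of n] c(2) d(2)
      dist_triangle[of "c (N n)" "d (N n)" p] by (simp_all add: L_def dist_commute)
  have sL: "0 \<le> s * L n" "s * L n \<le> L n" for n
    using s L(1)[of n] mult_right_mono[of s 1 "L n"] by auto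
  have "\<forall>n. \<exists>\<gamma>. unit_speed \<gamma> (L n) \<and> \<gamma> 0 = c (N n) \<and> \<gamma> (L n) = d (N n)"
    unfolding L_def using geodesic_space_ex_unit_speed[OF busemann_imp_geodesic[OF bs]] by metis
  then obtain \<sigma> where \<sigma>: "\<And>n. unit_speed (\<sigma> n) (L n)" "\<And>n. \<sigma> n 0 = c (N n)" "\<And>n. \<sigma> n (L n) = d (N n)"
    by metis
  define y where "y n = \<sigma> n (s * L n)" for n
  have yc: "dist (y n) (c (N n)) = s * L n" for n
    using unit_speed_dist0[OF \<sigma>(1) sL, of n] \<sigma>(2) by (simp add: y_def dist_commute)
  have yd: "dist (y n) (d (N n)) = (1 - s) * L n" for n
    using unit_speedD[OF \<sigma>(1)[of n] sL(1)[of n] sL(2)[of n], of "L n"] L(1)[of n] sL(2)[of n] \<sigma>(3) by (simp add: y_def algebra_simps)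
  have \<Phi>y: "\<Phi> (y n) \<le> - (1 - s) * e1 * N n" for n
  proof -
    have "\<Phi> (y n) \<le> (1 - s) * \<Phi> (c (N n)) + s * \<Phi> (d (N n))"
      using conv[OF \<sigma>(1), of s n] s \<sigma>(2,3) by (simp add: y_def)
    also have "\<dots> \<le> (1 - s) * (- e1 * N n) + s * 0"
      using \<Phi>c[of "N n"] d(3)[of "N n"] N[of n] s by (intro add_mono mult_left_mono) auto
    finally show ?thesis by (simp add: algebra_simps)
  qed
  define l where "l n = dist p (y n)" for n
  have l_le: "l n \<le> N n" for n
  proof -
    have "l n \<le> (1 - s) * dist p (c (N n)) + s * dist p (d (N n))"
      using busemann_convex_dist[OF bs \<sigma>(1), of s p n] s \<sigma>(2,3) by (simp add: l_def y_def)
    then show ?thesis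
      using rays_dist0[OF c(1), of "N n"] rays_dist0[OF d(1), of "N n"] N[of n] c(2) d(2) by (simp add: algebra_simps)
  qed
  \<comment> \<open>\<Phi> is 1-Lipschitz and vanishes at \<open>p\<close>, so its descent at
    \<open>y n\<close> forces distance from \<open>p\<close>; this makes the limit ratio
    \<open>a\<close> positive.\<close>
  have l_ge: "(1 - s) * e1 * N n \<le> l n" for n
    using \<Phi>y[of n] lip[of p "y n"] p by (simp add: l_def algebra_simps)
  have l_ge': "N n - 2 * s * N n \<le> l n" for n
  proof -
    have "s * L n \<le> 2 * s * N n" using mult_left_mono[OF L(2)[of n], of s] s(1) by simp
    then show ?thesis using rays_dist0[OF c(1), of "N n"] N[of n] c(2) dist_triangle[of p "c (N n)" "y n"] yc[of n]
      by (simp add: l_def)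
  qed
  have "\<forall>n. \<exists>\<gamma>. unit_speed \<gamma> (l n) \<and> \<gamma> 0 = p \<and> \<gamma> (l n) = y n"
    unfolding l_def using geodesic_space_ex_unit_speed[OF busemann_imp_geodesic[OF bs]] by metis
  then obtain P where P: "\<And>n. unit_speed (P n) (l n)" "\<And>n. P n 0 = p" "\<And>n. P n (l n) = y n" by metis
  have limN: "filterlim N at_top sequentially"
    unfolding N_def using filterlim_compose[OF filterlim_real_sequentially filterlim_Suc] .
  have pos: "0 < (1 - s) * e1" using s e1 by simp
  have "filterlim (\<lambda>n. (1 - s) * e1 * N n) at_top sequentially"
    by (rule filterlim_tendsto_pos_mult_at_top[OF tendsto_const pos limN])
  then have liml: "filterlim l at_top sequentially"
    by (rule filterlim_at_top_mono) (use l_ge in auto)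
  have a_bd: "l n / N n \<in> {(1 - s) * e1..1}" for n
    using l_ge[of n] l_le[of n] N[of n] by (simp add: field_simps)
  from compact_Icc[of "(1 - s) * e1" 1, unfolded compact_def, rule_format, of "\<lambda>n. l n / N n"] a_bd
  obtain a r0 where a: "a \<in> {(1 - s) * e1..1}" and r0: "strict_mono (r0::nat \<Rightarrow> nat)" "(\<lambda>n. l (r0 n) / N (r0 n)) \<longlonglongrightarrow> a"
    by (auto simp: o_def)
  obtain r1 b where r1: "strict_mono r1" and b: "b \<in> rays" "b 0 = p"
      "\<And>t. 0 \<le> t \<Longrightarrow> (\<lambda>n. P (r0 (r1 n)) t) \<longlonglongrightarrow> b t"
    using limit_ray[OF bs pr P(1,2) filterlim_compose[OF liml filterlim_subseq[OF r0(1)]]] by metis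
  define r where "r = r0 \<circ> r1"
  have r: "strict_mono r" unfolding r_def by (rule strict_mono_o[OF r0(1) r1])
  have b3: "(\<lambda>n. P (r n) t) \<longlonglongrightarrow> b t" if "0 \<le> t" for t using b(3)[OF that] by (simp add: r_def)
  have lima: "(\<lambda>n. l (r n) / N (r n)) \<longlonglongrightarrow> a"
    using LIMSEQ_subseq_LIMSEQ[OF r0(2) r1] by (simp add: r_def o_def)
  have a0: "0 < a" "a \<le> 1" using a pos by auto
  have ev: "\<forall>\<^sub>F n in sequentially. t \<le> l (r n) \<and> t \<le> N (r n)" for t
    using filterlim_at_top[THEN iffD1, OF liml] filterlim_at_top[THEN iffD1, OF limN]
    by (intro eventually_conj eventually_subseq[OF r]) auto

  txt \<open>Homothety with centre \<open>p\<close> carries \<open>y n\<close>, \<open>c (N n)\<close>, \<open>d (N n)\<close> to \<open>X n t\<close>, \<open>c t\<close>, \<open>d t\<close>.\<close>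
  define X where "X n t = P n (t / N n * l n)" for n t
  \<comment> \<open>Two errors vanish: the parameter \<open>t / N n * l n\<close> tends to
    \<open>a * t\<close>, and at the fixed parameter \<open>a * t\<close> the segments tend to
    \<open>b\<close>.\<close>
  have limX: "(\<lambda>n. X (r n) t) \<longlonglongrightarrow> b (a * t)" if t: "0 \<le> t" for t
  proof -
    have at: "0 \<le> a * t" using a0 t by simp
    have "(\<lambda>n. dist (X (r n) t) (b (a * t))) \<longlonglongrightarrow> 0"
    proof (rule tendsto_sandwich[OF _ _ tendsto_const])
      show "\<forall>\<^sub>F n in sequentially. dist (X (r n) t) (b (a * t))
          \<le> t * \<bar>l (r n) / N (r n) - a\<bar> + dist (P (r n) (a * t)) (b (a * t))"
        using ev[of t] ev[of "a * t"]
      proof eventually_elim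
        case (elim n)
        define m where "m = r n"
        have m: "t \<le> N m" "a * t \<le> l m" using elim by (auto simp: m_def)
        have "dist (P m (t / N m * l m)) (P m (a * t)) = \<bar>t / N m * l m - a * t\<bar>"
          using m t at N[of m] unit_speed_nonneg[OF P(1)[of m]] mult_right_mono[of "t / N m" 1 "l m"]
          by (intro unit_speedD[OF P(1)]) auto
        also have "t / N m * l m - a * t = t * (l m / N m - a)" by (simp add: algebra_simps)
        finally show ?case
          using t dist_triangle[of "X m t" "b (a * t)" "P m (a * t)"] by (simp add: X_def m_def abs_mult)
      qed
      have "(\<lambda>n. t * \<bar>l (r n) / N (r n) - a\<bar> + dist (P (r n) (a * t)) (b (a * t))) \<longlonglongrightarrow> t * \<bar>a - a\<bar> + dist (b (a * t)) (b (a * t))"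
        by (intro tendsto_intros lima b3 at)
      then show "(\<lambda>n. t * \<bar>l (r n) / N (r n) - a\<bar> + dist (P (r n) (a * t)) (b (a * t))) \<longlonglongrightarrow> 0" by simp
    qed auto
    then show ?thesis by (rule tendsto_dist_iff[THEN iffD2])
  qed
  have Xc: "dist (X n t) (c t) \<le> t / N n * (s * L n)" if "0 \<le> t" "t \<le> N n" for n t
    using busemann_contract[OF bs P(1)[of n] rays_unit_speed[OF c(1), of "N n"], of "t / N n"] N[of n] that P(2,3) c(2) yc
    by (simp add: X_def)
  have Xd: "dist (X n t) (d t) \<le> t / N n * ((1 - s) * L n)" if "0 \<le> t" "t \<le> N n" for n t
    using busemann_contract[OF bs P(1)[of n] rays_unit_speed[OF d(1), of "N n"], of "t / N n"] N[of n] that P(2,3) d(2) yd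
    by (simp add: X_def)

  \<comment> \<open>The times \<open>t\<close> and \<open>u\<close> are independent because each
    contraction bound scales with its own time. An excess towards \<open>c\<close> at a single time
    thus gives a saving towards \<open>d\<close> at all times.\<close>
  have sum: "dist (b (a * t)) (c t) / t + dist (b (a * u)) (d u) / u \<le> 2" if t: "0 < t" and u: "0 < u" for t u
  proof (rule tendsto_upperbound)
    show "(\<lambda>n. dist (X (r n) t) (c t) / t + dist (X (r n) u) (d u) / u) \<longlonglongrightarrow> dist (b (a * t)) (c t) / t + dist (b (a * u)) (d u) / u"
      using t u by (intro tendsto_intros limX) auto
    show "\<forall>\<^sub>F n in sequentially. dist (X (r n) t) (c t) / t + dist (X (r n) u) (d u) / u \<le> 2"
      using ev[of t] ev[of u]
    proof eventually_elim
      case (elim n)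
      define m where "m = r n"
      have "dist (X m t) (c t) / t + dist (X m u) (d u) / u \<le> s * L m / N m + (1 - s) * L m / N m"
        using Xc[of t m] Xd[of u m] elim t u by (intro add_mono) (auto simp: m_def field_simps)
      also have "\<dots> = L m / N m" by (simp add: algebra_simps diff_divide_distrib)
      also have "\<dots> \<le> 2" using L(2)[of m] N[of m] by (simp add: field_simps)
      finally show ?case by (simp add: m_def)
    qed
  qed simp
  have bd: "dist (b (a * t)) (d t) \<le> 2 * (1 - s) * t" if t: "0 < t" for t
  proof (rule tendsto_upperbound)
    show "(\<lambda>n. dist (X (r n) t) (d t)) \<longlonglongrightarrow> dist (b (a * t)) (d t)" using t by (intro tendsto_intros limX) auto
    show "\<forall>\<^sub>F n in sequentially. dist (X (r n) t) (d t) \<le> 2 * (1 - s) * t"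
      using ev[of t]
    proof eventually_elim
      case (elim n)
      define m where "m = r n"
      have "dist (X m t) (d t) \<le> t / N m * ((1 - s) * L m)" using Xd[of t m] elim t by (simp add: m_def)
      also have "\<dots> \<le> t / N m * ((1 - s) * (2 * N m))"
        using L(2)[of m] N[of m] s t by (intro mult_left_mono) auto
      also have "\<dots> = 2 * (1 - s) * t" using N[of m] by (simp add: field_simps)
      finally show ?case by (simp add: m_def)
    qed
  qed simp
  \<comment> \<open>Along the unit-speed ray \<open>b\<close> the rate of decrease is therefore at
    least \<open>(1 - s) * e1 / a\<close>.\<close>
  have \<Phi>b: "\<Phi> (b (a * t)) \<le> - (1 - s) * e1 * t" if t: "0 < t" for t
  proof (rule tendsto_upperbound)
    show "(\<lambda>n. \<Phi> (X (r n) t)) \<longlonglongrightarrow> \<Phi> (b (a * t))"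
      using continuous_on_tendsto_compose[OF cont limX[of t]] t by simp
    show "\<forall>\<^sub>F n in sequentially. \<Phi> (X (r n) t) \<le> - (1 - s) * e1 * t"
      using ev[of t]
    proof eventually_elim
      case (elim n)
      define m where "m = r n"
      have "\<Phi> (X m t) \<le> t / N m * \<Phi> (y m)"
        using conv[OF P(1), of "t / N m" m] P(2,3) p t elim N[of m] by (simp add: X_def m_def)
      also have "\<dots> \<le> t / N m * (- (1 - s) * e1 * N m)"
        using \<Phi>y[of m] N[of m] t by (intro mult_left_mono) auto
      also have "\<dots> = - (1 - s) * e1 * t" using N[of m] by (simp add: field_simps)
      finally show ?case by (simp add: m_def)
    qed
  qed simp
  have close: "dist (b K) (c K) \<le> \<delta>"
  proof (rule tendsto_upperbound)
    show "(\<lambda>n. dist (P (r n) K) (c K)) \<longlonglongrightarrow> dist (b K) (c K)" using K by (intro tendsto_intros b3) simp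
    show "\<forall>\<^sub>F n in sequentially. dist (P (r n) K) (c K) \<le> \<delta>"
      using ev[of K]
    proof eventually_elim
      case (elim n)
      define m where "m = r n"
      have m: "K \<le> l m" "K \<le> N m" using elim by (auto simp: m_def)
      have "dist (P m K) (c K) \<le> (1 - K / N m) * dist (P m 0) (c 0)
          + K / N m * (dist (P m (l m)) (c (N m)) + \<bar>l m - N m\<bar>)"
        using K N[of m] m by (intro busemann_compare[OF bs P(1) rays_unit_speed[OF c(1)]]) auto
      also have "\<dots> = K / N m * (s * L m + \<bar>l m - N m\<bar>)" using P(2,3) c(2) yc by simp
      also have "\<dots> \<le> K / N m * (s * (2 * N m) + 2 * s * N m)"
        using L(2)[of m] l_le[of m] l_ge'[of m] K N[of m] s by (intro mult_left_mono add_mono) auto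
      also have "\<dots> = 4 * s * K" using N[of m] by (simp add: field_simps)
      finally show ?case using s(3) by (simp add: m_def)
    qed
  qed simp
  \<comment> \<open>The limits control \<open>b\<close> at time \<open>a * t\<close>, but
    \<open>b\<close> and \<open>d\<close> have to be compared at equal times.\<close>
  have shift: "dist (b t) (d t) \<le> (1 - a) * t + dist (b (a * t)) (d t)" if t: "0 < t" for t
  proof -
    have "dist (b t) (b (a * t)) = (1 - a) * t"
      using rays_dist[OF b(1), of t "a * t"] t a0 mult_right_mono[OF a0(2), of t] by (simp add: algebra_simps)
    then show ?thesis using dist_triangle[of "b t" "d t" "b (a * t)"] by simp
  qed
  show ?thesis
  proof (cases "b = c")
    case True
    \<comment> \<open>All quotients along \<open>c = b\<close> are at least the left side, hence so
      is their infimum. The \<open>fold\<close> restores the occurrence of \<open>e1\<close> on the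
      left.\<close>
    have "(1 - s) * e1 / a \<le> e1"
      unfolding e1_def
    proof (rule cINF_greatest, fold e1_def)
      fix t :: real assume "t \<in> {0<..}"
      then show "(1 - s) * e1 / a \<le> - \<Phi> (c t) / t"
        using \<Phi>b[of "t / a"] a0 True by (simp add: field_simps)
    qed simp
    then have "(1 - s) * e1 \<le> a * e1" using a0 by (simp add: field_simps)
    then have "1 - s \<le> a" using e1 by simp
    \<comment> \<open>The shift costs at most \<open>s * t\<close>, so the total is at most
      \<open>s + 2 * (1 - s) = 2 - s\<close> times \<open>t\<close>.\<close>
    have "dist (b t) (d t) \<le> (2 - s) * t" if t: "0 < t" for t
      using shift[OF t] bd[OF t] mult_right_mono[OF \<open>1 - s \<le> a\<close>, of t] t by (simp add: algebra_simps)
    then show ?thesis using that[OF b(1,2) s(1) close] by blast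
  next
    case False
    then obtain u where u: "0 \<le> u" "b u \<noteq> c u" using rays_eqI[OF b(1) c(1)] by blast
    have u0: "0 < u" using u b(2) c(2) by (cases "u = 0") auto
    define k where "k = u / a"
    have k: "0 < k" "a * k = u" "u \<le> k" using u0 a0 by (auto simp: k_def field_simps)
    \<comment> \<open>Otherwise \<open>b u\<close>, at distance \<open>u\<close> from
      \<open>p\<close>, would lie on the segment from \<open>p\<close> to \<open>c k\<close> and
      equal \<open>c u\<close>.\<close>
    have "k - u < dist (b u) (c k)"
    proof (rule ccontr)
      assume "\<not> ?thesis"
      then have "b u = c u"
        using busemann_geodesic_unique[OF bs rays_unit_speed[OF c(1)], of k u "b u"] k u c(2) b(2)
          rays_dist0[OF b(1) u(1)] by simp
      with u show False by simp
    qed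
    \<comment> \<open>As \<open>k - u = (1 - a) * k\<close>, this is the relative excess at time
      \<open>k\<close>. In \<open>sum\<close> it leaves \<open>1 + a - \<kappa>\<close> for
      \<open>d\<close>, and the shift adds \<open>1 - a\<close>.\<close>
    define \<kappa> where "\<kappa> = dist (b u) (c k) / k - (1 - a)"
    have "0 < \<kappa>" using \<open>k - u < dist (b u) (c k)\<close> k by (simp add: \<kappa>_def field_simps)
    moreover have "dist (b t) (d t) \<le> (2 - \<kappa>) * t" if t: "0 < t" for t
      using shift[OF t] sum[OF k(1) t] k(2) t by (simp add: \<kappa>_def field_simps)
    ultimately show ?thesis using that b(1,2) close by blast
  qed
qed

section \<open>From tilted rays back to ideal points and cone neighbourhoods\<close>

theorem theorem4p1:
  fixes p :: "'a::metric_space"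
    and \<xi> \<eta> :: "(real \<Rightarrow> 'a) set"
    and \<Phi> :: "'a \<Rightarrow> real"
  assumes "busemann_space TYPE('a)"
    and "proper_space TYPE('a)"
    and "\<not> compact (UNIV :: 'a set)"
    and "\<xi> \<in> geodesic_boundary"
    and "\<eta> \<in> geodesic_boundary"
    and "const_class \<Phi> \<in> horo_boundary"
    and "Td_horo_le_half_pi (const_class \<Phi>) \<xi>"
    and "Td_horo_le_half_pi (const_class \<Phi>) \<eta>"
  shows "Td_le_pi p \<xi> \<eta>"
  unfolding Td_le_pi_def
proof (intro allI impI)
  note bs = assms(1) and pr = assms(2) and xi = assms(4) and eta = assms(5)
  fix U V assume U: "cone_nhd p \<xi> U" and V: "cone_nhd p \<eta> V"
  obtain K where K: "0 < K" "cone_basic p \<xi> K \<subseteq> U" using U by (auto simp: cone_nhd_def)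
  \<comment> \<open>Only \<xi> is perturbed; \<eta> serves as its own approximation.\<close>
  have "\<eta> \<in> V" using V eta by (auto simp: cone_nhd_def cone_basic_def)
  obtain X where lim: "\<And>y. (\<lambda>n. dist (X n) y - dist (X n) p) \<longlonglongrightarrow> \<Phi> y - \<Phi> p"
    and far: "filterlim (\<lambda>n. dist p (X n)) at_top sequentially"
    using horo_boundary_limit[OF pr assms(6)] by metis
  define \<Psi> where "\<Psi> x = \<Phi> x - \<Phi> p" for x
  have lip: "\<bar>\<Psi> x - \<Psi> y\<bar> \<le> dist x y" for x y
    using horo_lipschitz[OF lim] by (simp add: \<Psi>_def)
  have conv: "\<Psi> (\<gamma> (u * l)) \<le> (1 - u) * \<Psi> (\<gamma> 0) + u * \<Psi> (\<gamma> l)"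
    if "unit_speed \<gamma> l" "0 \<le> u" "u \<le> 1" for \<gamma> l u
    using horo_convex[OF bs lim that] by (simp add: \<Psi>_def algebra_simps)
  have desc: "\<exists>z. dist x z \<le> s \<and> \<Psi> z \<le> \<Psi> x - s" if s: "0 \<le> s" for x s
  proof -
    obtain z where "dist x z \<le> s" "\<Phi> z \<le> \<Phi> x - s" using horo_descent[OF bs pr lim far s] .
    then show ?thesis by (intro exI[of _ z]) (simp add: \<Psi>_def)
  qed
  have cont: "continuous_on UNIV \<Psi>"
    unfolding \<Psi>_def using horo_boundary_cont[OF assms(6)]
    by (auto simp: cont_functions_def intro!: continuous_intros)
  define c d where "c = ray_from p \<xi>" and "d = ray_from p \<eta>"
  have c: "c \<in> rays" "c 0 = p" "\<And>t. 0 \<le> t \<Longrightarrow> \<Psi> (c t) \<le> 0"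
    using ray_from[OF bs pr xi, of p] geodesic_boundary_asymptotic[OF xi]
      horo_nonincreasing_ray[OF bs lim assms(7) xi, of c]
    by (auto simp: c_def asymptotic_iff \<Psi>_def)
  have d: "d \<in> rays" "d 0 = p" "\<And>t. 0 \<le> t \<Longrightarrow> \<Psi> (d t) \<le> 0"
    using ray_from[OF bs pr eta, of p] geodesic_boundary_asymptotic[OF eta]
      horo_nonincreasing_ray[OF bs lim assms(8) eta, of d]
    by (auto simp: d_def asymptotic_iff \<Psi>_def)
  have \<Psi>p: "\<Psi> p = 0" by (simp add: \<Psi>_def)
  \<comment> \<open>Two tilts, each moving the point at time \<open>K\<close> by at most
    \<open>1 / 4\<close>, stay within the radius 1 of \<open>cone_basic\<close>.\<close>
  obtain c' e where c': "c' \<in> rays" "c' 0 = p" "0 < e" "\<And>t. 0 \<le> t \<Longrightarrow> \<Psi> (c' t) \<le> - e * t"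
      "dist (c' K) (c K) \<le> 1 / 4"
    using exists_descending_ray[OF bs pr cont conv desc \<Psi>p c K(1), of "1 / 4"] by auto
  obtain b \<kappa> where b: "b \<in> rays" "b 0 = p" "0 < \<kappa>" "dist (b K) (c' K) \<le> 1 / 4"
      "\<And>t. 0 < t \<Longrightarrow> dist (b t) (d t) \<le> (2 - \<kappa>) * t"
    using exists_close_ray_delta_less[OF bs pr lip conv \<Psi>p c'(1-4) d K(1), of "1 / 4"] by auto
  define \<theta> where "\<theta> = asymptotic `` {b}"
  have \<theta>: "\<theta> \<in> geodesic_boundary" "ray_from p \<theta> = b"
    unfolding \<theta>_def using ray_from_class[OF bs pr b(1,2)] by auto
  have "dist (c K) (b K) < 1"
    using b(4) c'(5) dist_triangle[of "c K" "b K" "c' K"] by (simp add: dist_commute)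
  then have "\<theta> \<in> U" using K(2) \<theta> by (auto simp: cone_basic_def c_def)
  moreover have "Td_delta p \<theta> \<eta> \<le> (2 - \<kappa>) / 2"
    using b(5) \<theta> by (intro Td_delta_le[OF bs pr \<theta>(1) eta]) (simp add: d_def)
  then have "Td_less_pi p \<theta> \<eta>" using b(3) by (simp add: Td_less_pi_def)
  ultimately show "\<exists>\<xi>'\<in>U. \<exists>\<eta>'\<in>V. Td_less_pi p \<xi>' \<eta>'" using \<open>\<eta> \<in> V\<close> by blast
qed

end
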